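(* Let $\mathcal H=(V,E)$ be a connected hypergraph with a fixed ribbon structure, base node $b_0$ and base edge $b_0b_1$ on $\mathrm{Bip}\,\mathcal H$. Run the (ht:$E$, cut:$V$) Bernardi process on a hypertree $\mathbf f$ on $E$ and let $T$ be the resulting spanning tree. Then running the (ht:$E$, cut:$E$) Bernardi process on $\mathbf f$, with base node $b_0$, base edge $b_0b_1^-$, and the reversed ribbon structure, also results in $T$.
   Context: $\mathcal H=(V,E)$: $V$ finite set, $E$ finite multiset of nonempty subsets of $V$; $\mathrm{Bip}\,\mathcal H$ has color classes $V$ (violet) and $E$ (emerald), $v$ joined to $e$ iff $v\in e$; connected means $\mathrm{Bip}\,\mathcal H$ connected. A ribbon structure assigns to each node $x$ a cyclic permutation of its incident edges; $xy^+$ (resp. $xy^-$) is the edge following (resp. preceding) $xy$ at $x$; subgraphs inherit restricted orders ($xy^+_G$ in subgraph $G$). The reversed ribbon structure inverts every cyclic permutation; $b_0b_1^-$ refers to the original structure. A hypertree on $E$ is $\mathbf f:E\to\mathbb Z_{\ge0}$ such that some spanning tree $T$ has $d_T(e)=\mathbf f(e)+1$ for all $e\in E$. Bernardi processes with hypertree $\mathbf f$ on $E$ and base node $b_0$, base edge $b_0b_1$ (for the given ribbon structure); current graph $G$ initially $\mathrm{Bip}\,\mathcal H$; outcome = final current graph. (ht:$E$, cut:$V$): if $b_0\in V$ start with current edge $b_0b_1$; if $b_0\in E$ start with $b_1b_0^+$, $b_0b_1$ counting as traversed from $b_0$. With current edge $ve$ ($v\in V$): if $\mathbf f$ is a hypertree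 on $E$ in $G-ve$, remove $ve$ and make $ve^+_G$ current; otherwise traverse $ve$ from $v$ and $ew:=ev^+_G$ from $e$, and make $we^+_G$ current. (ht:$E$, cut:$E$): if $b_0\in E$ start with $b_0b_1$; if $b_0\in V$ start with $b_1b_0^+$, $b_0b_1$ counting as traversed from $b_0$. With current edge $ev$ ($e\in E$): if $\mathbf f$ is a hypertree on $E$ in $G-ev$, remove $ev$ and make $ev^+_G$ current; otherwise traverse $ev$ from $e$ and $vd:=ve^+_G$ from $v$, and make $dv^+_G$ current. Each process stops right before an edge would be traversed a second time from the same endpoint. *)

theory Defs
  imports "HOL-Library.While_Combinator" "HOL-Combinatorics.Permutations" "HOL-Combinatorics.Orbits"
begin

section \<open>Hypergraphs and their bipartite graphs\<close>

text \<open>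
  The multiset of hyperedges is a finite family: \<open>E\<close> is a set of labels and \<open>inc e\<close> is the set of
  vertices of the hyperedge labelled \<open>e\<close>, so distinct labels may carry the same vertex set.

  All graphs below are subgraphs of the bipartite graph with the full node set \<open>V <+> E\<close>; such a
  graph is given by its edge set, the pair \<open>(v, e)\<close> being the edge that joins the violet node
  \<open>Inl v\<close> to the emerald node \<open>Inr e\<close>.
\<close>

definition hypergraph :: "'v set \<Rightarrow> 'e set \<Rightarrow> ('e \<Rightarrow> 'v set) \<Rightarrow> bool" where
  "hypergraph V E inc \<longleftrightarrow> finite V \<and> finite E \<and> (\<forall>e\<in>E. inc e \<noteq> {} \<and> inc e \<subseteq> V)"

definition Bip :: "'e set \<Rightarrow> ('e \<Rightarrow> 'v set) \<Rightarrow> ('v \<times> 'e) set" where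
  "Bip E inc = {(v, e). e \<in> E \<and> v \<in> inc e}"

datatype colour = Violet | Emerald

fun other :: "colour \<Rightarrow> colour" where
  "other Violet = Emerald"
| "other Emerald = Violet"

fun endpt :: "colour \<Rightarrow> 'v \<times> 'e \<Rightarrow> 'v + 'e" where
  "endpt Violet (v, e) = Inl v"
| "endpt Emerald (v, e) = Inr e"

definition incident_edges :: "('v \<times> 'e) set \<Rightarrow> 'v + 'e \<Rightarrow> ('v \<times> 'e) set" where
  "incident_edges G x = {\<epsilon> \<in> G. \<exists>c. endpt c \<epsilon> = x}"

definition adj :: "('v \<times> 'e) set \<Rightarrow> (('v + 'e) \<times> ('v + 'e)) set" where
  "adj G = {(endpt c \<epsilon>, endpt (other c) \<epsilon>) | c \<epsilon>. \<epsilon> \<in> G}"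

definition connected_graph :: "'v set \<Rightarrow> 'e set \<Rightarrow> ('v \<times> 'e) set \<Rightarrow> bool" where
  "connected_graph V E G \<longleftrightarrow> (\<forall>x \<in> V <+> E. \<forall>y \<in> V <+> E. (x, y) \<in> (adj G)\<^sup>*)"

definition is_cycle :: "('v \<times> 'e) set \<Rightarrow> ('v + 'e) list \<Rightarrow> bool" where
  "is_cycle G xs \<longleftrightarrow> 3 \<le> length xs \<and> distinct xs \<and>
     (\<forall>i < length xs. (xs ! i, xs ! (Suc i mod length xs)) \<in> adj G)"

definition spanning_tree :: "'v set \<Rightarrow> 'e set \<Rightarrow> ('v \<times> 'e) set \<Rightarrow> ('v \<times> 'e) set \<Rightarrow> bool" where
  "spanning_tree V E G T \<longleftrightarrow> T \<subseteq> G \<and> connected_graph V E T \<and> (\<nexists>xs. is_cycle T xs)"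

definition hypertree :: "'v set \<Rightarrow> 'e set \<Rightarrow> ('v \<times> 'e) set \<Rightarrow> ('e \<Rightarrow> nat) \<Rightarrow> bool" where
  "hypertree V E G f \<longleftrightarrow>
     (\<exists>T. spanning_tree V E G T \<and> (\<forall>e\<in>E. card (incident_edges T (Inr e)) = f e + 1))"


section \<open>Ribbon structures\<close>

text \<open>
  \<open>\<rho> x \<epsilon>\<close> is the edge following \<open>\<epsilon>\<close> at the node \<open>x\<close>. The case of an empty set of incident edges
  is separate because \<^const>\<open>cyclic_on\<close> only holds on nonempty sets.
\<close>

type_synonym ('v, 'e) ribbon = "'v + 'e \<Rightarrow> 'v \<times> 'e \<Rightarrow> 'v \<times> 'e"

definition ribbon_structure ::
    "'v set \<Rightarrow> 'e set \<Rightarrow> ('v \<times> 'e) set \<Rightarrow> ('v, 'e) ribbon \<Rightarrow> bool" where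
  "ribbon_structure V E G \<rho> \<longleftrightarrow> (\<forall>x \<in> V <+> E. \<rho> x permutes incident_edges G x \<and>
     (incident_edges G x = {} \<or> cyclic_on (\<rho> x) (incident_edges G x)))"

definition reversed :: "('v, 'e) ribbon \<Rightarrow> ('v, 'e) ribbon" where
  "reversed \<rho> = (\<lambda>x. inv (\<rho> x))"

text \<open>
  The cyclic order restricted to a subgraph \<open>G\<close>: the first edge of \<open>G\<close> met when moving on from \<open>\<epsilon>\<close>
  at \<open>x\<close>. It is \<open>\<epsilon>\<close> itself if \<open>\<epsilon>\<close> is the only edge of \<open>G\<close> at \<open>x\<close>.
\<close>

definition next_edge ::
    "('v, 'e) ribbon \<Rightarrow> ('v \<times> 'e) set \<Rightarrow> 'v + 'e \<Rightarrow> 'v \<times> 'e \<Rightarrow> 'v \<times> 'e" where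
  "next_edge \<rho> G x \<epsilon> = (\<rho> x ^^ (LEAST k. 0 < k \<and> (\<rho> x ^^ k) \<epsilon> \<in> G)) \<epsilon>"


section \<open>The Bernardi processes for hypertrees on the emerald class\<close>

text \<open>
  The colour \<open>c\<close> is the class at which edges are cut: \<^const>\<open>Violet\<close> gives the process
  (ht:\<open>E\<close>, cut:\<open>V\<close>) and \<^const>\<open>Emerald\<close> gives (ht:\<open>E\<close>, cut:\<open>E\<close>). In both, \<open>f\<close> is a hypertree
  on \<open>E\<close>.

  A state consists of the current graph, the current edge (considered from its endpoint of colour
  \<open>c\<close>), and the set of traversals made so far, \<open>(\<epsilon>, x)\<close> meaning that \<open>\<epsilon>\<close> was traversed from \<open>x\<close>.
\<close>

type_synonym ('v, 'e) state =
  "('v \<times> 'e) set \<times> ('v \<times> 'e) \<times> (('v \<times> 'e) \<times> ('v + 'e)) set"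

definition bernardi_start ::
    "colour \<Rightarrow> ('v \<times> 'e) set \<Rightarrow> ('v, 'e) ribbon \<Rightarrow> 'v + 'e \<Rightarrow> 'v \<times> 'e \<Rightarrow> ('v, 'e) state" where
  "bernardi_start c G \<rho> b\<^sub>0 \<beta> =
     (if b\<^sub>0 = endpt c \<beta> then (G, \<beta>, {})
      else (G, next_edge \<rho> G (endpt c \<beta>) \<beta>, {(\<beta>, b\<^sub>0)}))"

definition bernardi_step ::
    "colour \<Rightarrow> 'v set \<Rightarrow> 'e set \<Rightarrow> ('v, 'e) ribbon \<Rightarrow> ('e \<Rightarrow> nat) \<Rightarrow>
     ('v, 'e) state \<Rightarrow> ('v, 'e) state" where
  "bernardi_step c V E \<rho> f = (\<lambda>(G, \<epsilon>, R).
     if hypertree V E (G - {\<epsilon>}) f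
     then (G - {\<epsilon>}, next_edge \<rho> G (endpt c \<epsilon>) \<epsilon>, R)
     else let \<epsilon>' = next_edge \<rho> G (endpt (other c) \<epsilon>) \<epsilon>
          in (G, next_edge \<rho> G (endpt c \<epsilon>') \<epsilon>',
              R \<union> {(\<epsilon>, endpt c \<epsilon>), (\<epsilon>', endpt (other c) \<epsilon>')}))"

text \<open>
  The process stops right before an edge would be traversed a second time from the same endpoint.
  A step that does not remove an edge makes two traversals, and either one may be the repetition;
  stopping between the two leaves the current graph as it was before the step.
\<close>

definition bernardi_stop ::
    "colour \<Rightarrow> 'v set \<Rightarrow> 'e set \<Rightarrow> ('v, 'e) ribbon \<Rightarrow> ('e \<Rightarrow> nat) \<Rightarrow> ('v, 'e) state \<Rightarrow> bool" where
  "bernardi_stop c V E \<rho> f = (\<lambda>(G, \<epsilon>, R).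
     \<not> hypertree V E (G - {\<epsilon>}) f \<and>
     (let \<epsilon>' = next_edge \<rho> G (endpt (other c) \<epsilon>) \<epsilon>
      in (\<epsilon>, endpt c \<epsilon>) \<in> R \<or> (\<epsilon>', endpt (other c) \<epsilon>') \<in> R))"

text \<open>
  The outcome is \<open>Some T\<close> if the process stops with current graph \<open>T\<close>, and \<^const>\<open>None\<close> if it
  runs forever.
\<close>

definition bernardi_outcome ::
    "colour \<Rightarrow> 'v set \<Rightarrow> 'e set \<Rightarrow> ('e \<Rightarrow> 'v set) \<Rightarrow> ('v, 'e) ribbon \<Rightarrow> ('e \<Rightarrow> nat) \<Rightarrow>
     'v + 'e \<Rightarrow> 'v \<times> 'e \<Rightarrow> ('v \<times> 'e) set option" where
  "bernardi_outcome c V E inc \<rho> f b\<^sub>0 \<beta> =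
     map_option fst (while_option (\<lambda>s. \<not> bernardi_stop c V E \<rho> f s) (bernardi_step c V E \<rho> f)
       (bernardi_start c (Bip E inc) \<rho> b\<^sub>0 \<beta>))"

end

theory Submission
  imports Defs "HOL-Library.Transitive_Closure_Table"
begin

text \<open>
  The tour of a spanning tree \<open>T\<close> walks around \<open>T\<close> and meets every edge outside \<open>T\<close> once from each
  endpoint. Call \<open>T\<close> cut at the colour \<open>c\<close> if it meets each of them first at the endpoint of colour \<open>c\<close>.
  Reversing the ribbon structure and the base edge runs the tour backwards, so a tree cut at the
  violet nodes becomes one cut at the emerald nodes. It is therefore enough that some tree that
  realises \<open>f\<close> is cut at the violet nodes, and that the process with cut colour \<open>c\<close> follows the tour
  of any tree that realises \<open>f\<close> and is cut at \<open>c\<close>.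

  For the existence, compare the trees that realise \<open>f\<close> at the first difference of their tours,
  preferring to omit an edge met at its violet end and to keep one met at its emerald end. If the
  best tree omits an edge met first at its emerald end \<open>e\<close>, then exchanging it with the edge at \<open>e\<close>
  on the cycle that it closes gives a better one.

  For the second claim, let \<open>\<epsilon>\<close> be a tree edge that the process meets at colour \<open>c\<close>. Every
  non-tree edge that joins the two sides of \<open>\<epsilon>\<close> in the same direction as \<open>\<epsilon>\<close> has been met at \<open>c\<close>
  before and is gone, and then a degree count shows that \<open>f\<close> is not a hypertree without \<open>\<epsilon>\<close>.
\<close>

section \<open>Forests\<close>

lemma other_other [simp]: "other (other c) = c"
  by (cases c) auto

lemma other_neq [simp]: "other c \<noteq> c" "c \<noteq> other c"
  by (cases c; simp)+

lemma colour_cases: "c' = c \<or> c' = other c"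
  by (cases c; cases c') auto

lemma endpt_colour: "endpt c \<epsilon> = endpt c' \<epsilon>' \<Longrightarrow> c = c'"
  by (cases c; cases c'; cases \<epsilon>; cases \<epsilon>') auto

lemma endpt_inj: "endpt c \<epsilon> = endpt c \<epsilon>' \<Longrightarrow> endpt (other c) \<epsilon> = endpt (other c) \<epsilon>' \<Longrightarrow> \<epsilon> = \<epsilon>'"
  by (cases c; cases \<epsilon>; cases \<epsilon>') auto

lemma adjI [intro]: "\<epsilon> \<in> G \<Longrightarrow> (endpt c \<epsilon>, endpt (other c) \<epsilon>) \<in> adj G"
  unfolding adj_def by blast

lemma adjE [elim?]:
  assumes "(x, y) \<in> adj G"
  obtains c \<epsilon> where "\<epsilon> \<in> G" "x = endpt c \<epsilon>" "y = endpt (other c) \<epsilon>"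
  using assms by (auto simp: adj_def)

lemma sym_adj: "sym (adj G)"
proof (rule symI)
  fix x y assume "(x, y) \<in> adj G"
  then obtain c \<epsilon> where \<epsilon>: "\<epsilon> \<in> G" "x = endpt c \<epsilon>" "y = endpt (other c) \<epsilon>" by (rule adjE)
  then show "(y, x) \<in> adj G" using adjI[OF \<epsilon>(1), of "other c"] by simp
qed

lemma joined_sym: "(x, y) \<in> (adj G)\<^sup>* \<Longrightarrow> (y, x) \<in> (adj G)\<^sup>*"
  by (rule symD[OF sym_rtrancl[OF sym_adj]])

lemma adj_mono: "F \<subseteq> G \<Longrightarrow> adj F \<subseteq> adj G"
  by (auto simp: adj_def)

lemma joined_mono: "(x, y) \<in> (adj F)\<^sup>* \<Longrightarrow> F \<subseteq> G \<Longrightarrow> (x, y) \<in> (adj G)\<^sup>*"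
  using rtrancl_mono[OF adj_mono] by (rule subsetD)

text \<open>A walk needs \<open>\<epsilon>\<close> at most once: crossing back returns to the part
  reached before the crossing, and crossing again in the same direction can restart right after the
  first crossing.\<close>

lemma joined_insert:
  assumes "(x, y) \<in> (adj (insert \<epsilon> F))\<^sup>*"
  shows "(x, y) \<in> (adj F)\<^sup>* \<or>
    (\<exists>c. (x, endpt c \<epsilon>) \<in> (adj F)\<^sup>* \<and> (endpt (other c) \<epsilon>, y) \<in> (adj F)\<^sup>*)"
  using assms
proof (induction rule: rtrancl_induct)
  case (step y z)
  from step(2) obtain c \<delta> where \<delta>: "\<delta> \<in> insert \<epsilon> F" "y = endpt c \<delta>" "z = endpt (other c) \<delta>"
    by (rule adjE)
  show ?case
  proof (cases "\<delta> \<in> F")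
    case True
    then have "(y, z) \<in> adj F" using \<delta> by auto
    then show ?thesis using step.IH by (meson rtrancl.rtrancl_into_rtrancl)
  next
    case False
    then have [simp]: "\<delta> = \<epsilon>" using \<delta> by auto
    from step.IH show ?thesis
    proof (elim disjE exE conjE)
      fix c' assume c': "(x, endpt c' \<epsilon>) \<in> (adj F)\<^sup>*" "(endpt (other c') \<epsilon>, y) \<in> (adj F)\<^sup>*"
      show ?thesis
      proof (cases "c = c'")
        case False
        then have "c = other c'" using colour_cases by blast
        then show ?thesis using c' \<delta> by auto
      qed (use c' \<delta> in auto)
    qed (use \<delta> in auto)
  qed
qed simp

text \<open>Every edge is a bridge. This form of acyclicity suits the insertion and deletion of
  single edges; \<open>forest_iff_no_cycle\<close> links it to \<open>is_cycle\<close>.\<close>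

definition forest :: "('v \<times> 'e) set \<Rightarrow> bool" where
  "forest F \<longleftrightarrow> (\<forall>\<epsilon>\<in>F. (endpt Violet \<epsilon>, endpt Emerald \<epsilon>) \<notin> (adj (F - {\<epsilon>}))\<^sup>*)"

lemma forestD:
  assumes "forest F" "\<epsilon> \<in> F"
  shows "(endpt c \<epsilon>, endpt (other c) \<epsilon>) \<notin> (adj (F - {\<epsilon>}))\<^sup>*"
  using assms joined_sym unfolding forest_def by (cases c) fastforce+

lemma forest_subset: "forest F \<Longrightarrow> F' \<subseteq> F \<Longrightarrow> forest F'"
  unfolding forest_def by (meson Diff_mono joined_mono order_refl subsetD)

text \<open>A cycle without its first edge still joins the ends of that edge. Conversely, a simple
  path that joins the ends of \<open>\<epsilon>\<close> and avoids \<open>\<epsilon>\<close> closes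
  up with \<open>\<epsilon>\<close>.\<close>

lemma forest_iff_no_cycle: "forest F \<longleftrightarrow> (\<nexists>xs. is_cycle F xs)"
proof
  assume F: "forest F"
  show "\<nexists>xs. is_cycle F xs"
  proof
    assume "\<exists>xs. is_cycle F xs"
    then obtain xs where len: "3 \<le> length xs" and dist: "distinct xs"
      and adj: "\<And>i. i < length xs \<Longrightarrow> (xs ! i, xs ! (Suc i mod length xs)) \<in> adj F"
      unfolding is_cycle_def by auto
    define n where "n = length xs"
    have "(xs ! 0, xs ! 1) \<in> adj F"
      using adj[of 0] len by (cases "xs = []") auto
    then obtain c \<epsilon> where \<epsilon>: "\<epsilon> \<in> F" "xs ! 0 = endpt c \<epsilon>" "xs ! 1 = endpt (other c) \<epsilon>"
      by (rule adjE)
    have step: "(xs ! i, xs ! (Suc i mod n)) \<in> adj (F - {\<epsilon>})" if i: "1 \<le> i" "i < n" for i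
    proof -
      obtain c' \<delta> where \<delta>: "\<delta> \<in> F" "xs ! i = endpt c' \<delta>" "xs ! (Suc i mod n) = endpt (other c') \<delta>"
        using adj[of i] i unfolding n_def by (auto elim: adjE)
      \<comment> \<open>A pair with the same two nodes could only start at index 1, and then
        \<open>xs ! 2\<close> would repeat one of the first two nodes.\<close>
      have "{xs ! i, xs ! (Suc i mod n)} \<noteq> {xs ! 0, xs ! 1}"
      proof
        assume *: "{xs ! i, xs ! (Suc i mod n)} = {xs ! 0, xs ! 1}"
        have "xs ! i \<in> {xs ! 0, xs ! 1}" using * by blast
        moreover have "i < length xs" "0 < length xs" "1 < length xs" using i len n_def by auto
        ultimately have "i = 1" using i(1) nth_eq_iff_index_eq[OF dist, of i 0]
            nth_eq_iff_index_eq[OF dist, of i 1] by (metis empty_iff insert_iff not_one_le_zero)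
        then have "xs ! 2 \<in> {xs ! 0, xs ! 1}" using * len unfolding n_def by (auto simp: numeral_2_eq_2)
        moreover have "2 < length xs" "1 < length xs" "0 < length xs" using len by auto
        ultimately show False using nth_eq_iff_index_eq[OF dist, of 2 0]
            nth_eq_iff_index_eq[OF dist, of 2 1] by (simp only: insert_iff empty_iff) simp
      qed
      then have "\<delta> \<noteq> \<epsilon>"
        using \<delta> \<epsilon> colour_cases[of c' c] by auto
      then show ?thesis using \<delta> by auto
    qed
    have "(xs ! 1, xs ! k) \<in> (adj (F - {\<epsilon>}))\<^sup>*" if "1 \<le> k" "k < n" for k
      using that
    proof (induction k rule: nat_induct_at_least)
      case (Suc k)
      then show ?case using step[of k] by (auto intro: rtrancl_into_rtrancl)
    qed auto
    from this[of "n - 1"] have "(xs ! 1, xs ! (n - 1)) \<in> (adj (F - {\<epsilon>}))\<^sup>*"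
      using len unfolding n_def by simp
    moreover have "Suc (n - 1) mod n = 0" using len unfolding n_def by (cases "length xs") auto
    then have "(xs ! (n - 1), xs ! 0) \<in> adj (F - {\<epsilon>})"
      using step[of "n - 1"] len unfolding n_def by simp
    ultimately have "(xs ! 1, xs ! 0) \<in> (adj (F - {\<epsilon>}))\<^sup>*"
      by (rule rtrancl_into_rtrancl)
    then show False using forestD[OF F \<epsilon>(1), of "other c"] \<epsilon> by simp
  qed
next
  assume no: "\<nexists>xs. is_cycle F xs"
  show "forest F" unfolding forest_def
  proof (intro ballI notI)
    fix \<epsilon> assume \<epsilon>: "\<epsilon> \<in> F" and j: "(endpt Violet \<epsilon>, endpt Emerald \<epsilon>) \<in> (adj (F - {\<epsilon>}))\<^sup>*"
    let ?x = "endpt Violet \<epsilon>" and ?y = "endpt Emerald \<epsilon>"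
    let ?r = "\<lambda>a b. (a, b) \<in> adj (F - {\<epsilon>})"
    have "?r\<^sup>*\<^sup>* ?x ?y" using j unfolding rtrancl_def by simp
    then obtain ps' where "rtrancl_path ?r ?x ps' ?y" by (auto simp: rtranclp_eq_rtrancl_path)
    then obtain ps where ps: "rtrancl_path ?r ?x ps ?y" "distinct (?x # ps)"
      by (rule rtrancl_path_distinct)
    have xy: "?x \<noteq> ?y" using endpt_colour by blast
    have ne: "ps \<noteq> []" using ps(1) xy by (auto elim: rtrancl_path.cases)
    have last: "last ps = ?y" using rtrancl_path_last[OF ps(1) ne] .
    have nth: "\<And>i. i < length ps \<Longrightarrow> ?r ((?x # ps) ! i) (ps ! i)"
      using rtrancl_path_nth[OF ps(1)] by auto
    \<comment> \<open>An edge is determined by its two ends, so a path of length one would be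
      \<open>\<epsilon>\<close> itself, which is deleted.\<close>
    have "length ps \<noteq> 1"
    proof
      assume "length ps = 1"
      then have "(?x, ?y) \<in> adj (F - {\<epsilon>})" using nth[of 0] last
        by (cases ps) auto
      then obtain c \<delta> where "\<delta> \<in> F - {\<epsilon>}" "?x = endpt c \<delta>" "?y = endpt (other c) \<delta>" by (rule adjE)
      moreover then have "c = Violet" using endpt_colour by metis
      ultimately show False using endpt_inj[of Violet \<epsilon> \<delta>] by auto
    qed
    then have "3 \<le> length (?x # ps)" using ne by (cases ps rule: remdups_adj.cases) auto
    moreover have "((?x # ps) ! i, (?x # ps) ! (Suc i mod length (?x # ps))) \<in> adj F"
      if "i < length (?x # ps)" for i
    proof (cases "i < length ps")
      case True
      then show ?thesis using nth[OF True] adj_mono[of "F - {\<epsilon>}" F] by auto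
    next
      case False
      then have "i = length ps" using that by simp
      then have "(?x # ps) ! i = ?y" using last ne by (simp add: last_conv_nth)
      moreover have "(?y, ?x) \<in> adj F" using adjI[OF \<epsilon>, of Emerald] by simp
      ultimately show ?thesis using \<open>i = length ps\<close> by simp
    qed
    ultimately have "is_cycle F (?x # ps)" unfolding is_cycle_def using ps(2) by blast
    then show False using no by blast
  qed
qed

lemma spanning_tree_iff: "spanning_tree V E G T \<longleftrightarrow> T \<subseteq> G \<and> connected_graph V E T \<and> forest T"
  by (simp add: spanning_tree_def forest_iff_no_cycle)

section \<open>Counting connected components\<close>

definition comps :: "('v + 'e) set \<Rightarrow> ('v \<times> 'e) set \<Rightarrow> ('v + 'e) set set" where
  "comps S F = (\<lambda>x. {y \<in> S. (x, y) \<in> (adj F)\<^sup>*}) ` S"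

definition inside :: "('v \<times> 'e) set \<Rightarrow> ('v + 'e) set \<Rightarrow> bool" where
  "inside F S \<longleftrightarrow> (\<forall>\<epsilon>\<in>F. \<forall>c. endpt c \<epsilon> \<in> S)"

lemma finite_comps [simp]: "finite S \<Longrightarrow> finite (comps S F)"
  by (simp add: comps_def)

lemma comps_empty: "comps S {} = (\<lambda>x. {x}) ` S"
  by (auto simp: comps_def adj_def)

lemma comps_insert_joined:
  assumes j: "(endpt Violet \<epsilon>, endpt Emerald \<epsilon>) \<in> (adj F)\<^sup>*"
  shows "comps S (insert \<epsilon> F) = comps S F"
proof -
  have "(endpt c \<epsilon>, endpt (other c) \<epsilon>) \<in> (adj F)\<^sup>*" for c
    using j joined_sym[OF j] by (cases c) auto
  then have "(x, y) \<in> (adj (insert \<epsilon> F))\<^sup>* \<longleftrightarrow> (x, y) \<in> (adj F)\<^sup>*" for x y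
    using joined_insert[of x y \<epsilon> F] joined_mono[of x y F "insert \<epsilon> F"] by (meson rtrancl_trans subset_insertI)
  then show ?thesis by (simp add: comps_def)
qed

text \<open>Only the components of the two ends of \<open>\<epsilon>\<close> change: they are
  distinct, and they merge into one.\<close>

lemma card_comps_insert:
  assumes S: "finite S" and ends: "\<And>c. endpt c \<epsilon> \<in> S"
    and nj: "(endpt Violet \<epsilon>, endpt Emerald \<epsilon>) \<notin> (adj F)\<^sup>*"
  shows "card (comps S F) = Suc (card (comps S (insert \<epsilon> F)))"
proof -
  define C where "C x = {y \<in> S. (x, y) \<in> (adj F)\<^sup>*}" for x
  define D where "D x = {y \<in> S. (x, y) \<in> (adj (insert \<epsilon> F))\<^sup>*}" for x
  let ?v = "endpt Violet \<epsilon>" and ?e = "endpt Emerald \<epsilon>"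
  have comps: "comps S F = C ` S" "comps S (insert \<epsilon> F) = D ` S"
    by (auto simp: comps_def C_def D_def)
  have C_eq: "C x = C y" if "(x, y) \<in> (adj F)\<^sup>*" for x y
    unfolding C_def using that joined_sym by (auto intro: rtrancl_trans)
  have ve: "(?v, ?e) \<in> (adj (insert \<epsilon> F))\<^sup>*" using adjI[of \<epsilon> "insert \<epsilon> F" Violet] by auto
  have ev: "(?e, ?v) \<in> (adj (insert \<epsilon> F))\<^sup>*" using joined_sym[OF ve] .
  have mono: "(x, y) \<in> (adj F)\<^sup>* \<Longrightarrow> (x, y) \<in> (adj (insert \<epsilon> F))\<^sup>*" for x y
    by (erule joined_mono) auto
  have D_v: "D ?v = C ?v \<union> C ?e"
  proof (intro equalityI subsetI)
    fix y assume "y \<in> D ?v"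
    then have y: "y \<in> S" "(?v, y) \<in> (adj (insert \<epsilon> F))\<^sup>*" by (auto simp: D_def)
    from joined_insert[OF y(2)] show "y \<in> C ?v \<union> C ?e"
    proof (elim disjE exE conjE)
      fix c assume "(endpt (other c) \<epsilon>, y) \<in> (adj F)\<^sup>*"
      then show ?thesis using y(1) by (cases c) (auto simp: C_def)
    qed (use y in \<open>auto simp: C_def\<close>)
  next
    fix y assume "y \<in> C ?v \<union> C ?e"
    then show "y \<in> D ?v" unfolding C_def D_def using ve mono by (auto intro: rtrancl_trans)
  qed
  have D_eq: "D x = (if x \<in> C ?v \<union> C ?e then D ?v else C x)" if x: "x \<in> S" for x
  proof (cases "x \<in> C ?v \<union> C ?e")
    case True
    then have "(?v, x) \<in> (adj (insert \<epsilon> F))\<^sup>*" using D_v by (auto simp: D_def)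
    then have "D x = D ?v" unfolding D_def using joined_sym by (auto intro: rtrancl_trans)
    then show ?thesis using True by simp
  next
    case False
    then have no: "(x, endpt c \<epsilon>) \<notin> (adj F)\<^sup>*" for c
      using x joined_sym[of x _ F] by (cases c) (auto simp: C_def)
    have "D x = C x"
      unfolding D_def C_def using joined_insert[of x _ \<epsilon> F] no mono by blast
    then show ?thesis using False by simp
  qed
  have D_img: "D ` S = insert (D ?v) (C ` S - {C ?v, C ?e})"
  proof (intro equalityI subsetI)
    fix Z assume "Z \<in> D ` S"
    then obtain x where x: "x \<in> S" "Z = D x" by auto
    show "Z \<in> insert (D ?v) (C ` S - {C ?v, C ?e})"
    proof (cases "x \<in> C ?v \<union> C ?e")
      case True
      then show ?thesis using D_eq[OF x(1)] x by simp
    next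
      case False
      moreover have "x \<in> C x" using x by (simp add: C_def)
      ultimately have "C x \<notin> {C ?v, C ?e}" by blast
      then show ?thesis using D_eq[OF x(1)] x False by auto
    qed
  next
    fix Z assume "Z \<in> insert (D ?v) (C ` S - {C ?v, C ?e})"
    then consider "Z = D ?v" | x where "x \<in> S" "Z = C x" "C x \<noteq> C ?v" "C x \<noteq> C ?e" by auto
    then show "Z \<in> D ` S"
    proof cases
      case 1 then show ?thesis using ends[of Violet] by auto
    next
      case 2
      then have "x \<notin> C ?v \<union> C ?e" using C_eq[of ?v x] C_eq[of ?e x] by (auto simp: C_def)
      then show ?thesis using D_eq[OF 2(1)] 2 by auto
    qed
  qed
  have notin: "D ?v \<notin> C ` S - {C ?v, C ?e}"
  proof
    assume "D ?v \<in> C ` S - {C ?v, C ?e}"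
    then obtain x where x: "x \<in> S" "D ?v = C x" "C x \<noteq> C ?v" by auto
    have "?v \<in> C x" using x D_v ends[of Violet] by (auto simp: C_def)
    then show False using C_eq[of x ?v] x by (auto simp: C_def)
  qed
  have neq: "C ?v \<noteq> C ?e" using nj ends[of Emerald] by (auto simp: C_def)
  have fin: "finite (C ` S)" using S by simp
  have sub: "{C ?v, C ?e} \<subseteq> C ` S" using ends by blast
  then have "card {C ?v, C ?e} \<le> card (C ` S)" using card_mono[OF fin] by blast
  then show ?thesis
    unfolding comps D_img using notin neq fin sub by (simp add: card_Diff_subset)
qed

text \<open>Starting from \<open>card S\<close> single nodes, each edge lowers the number of
  components by at most one.\<close>

lemma card_le_card_comps:
  assumes "finite F" "finite S" "inside F S"
  shows "card S \<le> card F + card (comps S F)"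
  using assms
proof (induction F)
  case empty
  then show ?case by (simp add: comps_empty card_image)
next
  case (insert \<epsilon> F)
  have "card (comps S F) \<le> Suc (card (comps S (insert \<epsilon> F)))"
    using card_comps_insert[of S \<epsilon> F] comps_insert_joined[of \<epsilon> F S] insert.prems
    by (cases "(endpt Violet \<epsilon>, endpt Emerald \<epsilon>) \<in> (adj F)\<^sup>*") (auto simp: inside_def)
  then show ?case using insert by (auto simp: inside_def)
qed

text \<open>Each edge of a forest joins two different components when it is inserted, so it lowers
  their number by exactly one.\<close>

lemma forest_card_comps:
  assumes "finite F" "finite S" "inside F S" "forest F"
  shows "card F + card (comps S F) = card S"
  using assms
proof (induction F)
  case empty
  then show ?case by (simp add: comps_empty card_image)
next
  case (insert \<epsilon> F)
  have "(endpt Violet \<epsilon>, endpt Emerald \<epsilon>) \<notin> (adj F)\<^sup>*"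
    using forestD[OF insert.prems(3), of \<epsilon> Violet] insert.hyps by simp
  then have "card (comps S F) = Suc (card (comps S (insert \<epsilon> F)))"
    using card_comps_insert[of S \<epsilon> F] insert.prems by (auto simp: inside_def)
  moreover have "forest F" using insert.prems(3) by (rule forest_subset) auto
  ultimately show ?case using insert by (auto simp: inside_def)
qed

text \<open>Deleting an edge that is not a bridge would keep the components and break the bound
  \<open>card_le_card_comps\<close>. Trees can thus be certified by counting.\<close>

lemma forestI_card:
  assumes fin: "finite F" "finite S" and ins: "inside F S" and card: "card F + card (comps S F) = card S"
  shows "forest F"
  unfolding forest_def
proof (intro ballI notI)
  fix \<epsilon> assume \<epsilon>: "\<epsilon> \<in> F" and j: "(endpt Violet \<epsilon>, endpt Emerald \<epsilon>) \<in> (adj (F - {\<epsilon>}))\<^sup>*"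
  have "comps S F = comps S (F - {\<epsilon>})"
    using comps_insert_joined[OF j, of S] \<epsilon> by (simp add: insert_absorb)
  moreover have "card S \<le> card (F - {\<epsilon>}) + card (comps S (F - {\<epsilon>}))"
    using card_le_card_comps[of "F - {\<epsilon>}" S] fin ins by (auto simp: inside_def)
  moreover have "card F > 0" using \<epsilon> fin by (auto simp: card_gt_0_iff)
  ultimately show False using card \<epsilon> fin by (simp add: card_Diff_singleton)
qed

lemma card_comps_connected:
  assumes "S \<noteq> {}" "\<And>x y. x \<in> S \<Longrightarrow> y \<in> S \<Longrightarrow> (x, y) \<in> (adj F)\<^sup>*"
  shows "card (comps S F) = 1"
proof -
  have "comps S F = {S}" using assms by (auto simp: comps_def)
  then show ?thesis by simp
qed

text \<open>By \<open>j\<close>, \<open>\<epsilon>\<close> reconnects the two parts left by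
  \<open>\<epsilon>'\<close>, so the new graph is connected; it has as many edges as
  \<open>T\<close>, so the component count makes it a forest.\<close>

lemma spanning_tree_exchange:
  assumes fin: "finite V" "finite E" and B: "B \<subseteq> V \<times> E"
    and T: "spanning_tree V E B T" and \<epsilon>': "\<epsilon>' \<in> T" and \<epsilon>: "\<epsilon> \<in> B" "\<epsilon> \<notin> T"
    and j: "\<And>c. (endpt c \<epsilon>, endpt c \<epsilon>') \<in> (adj (T - {\<epsilon>'}))\<^sup>*"
  shows "spanning_tree V E B (insert \<epsilon> (T - {\<epsilon>'}))"
proof -
  let ?T' = "insert \<epsilon> (T - {\<epsilon>'})" and ?N = "V <+> E"
  have N: "finite ?N" using fin by simp
  have "finite B" using fin B by (meson finite_SigmaI finite_subset)
  then have finT: "finite T" using T finite_subset unfolding spanning_tree_iff by blast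
  have ins: "inside G ?N" if "G \<subseteq> B" for G
    unfolding inside_def
  proof (intro ballI allI)
    fix \<delta> c assume "\<delta> \<in> G" then show "endpt c \<delta> \<in> ?N" using that B by (cases \<delta>; cases c) auto
  qed
  have j': "(endpt c \<epsilon>, endpt c \<epsilon>') \<in> (adj ?T')\<^sup>*" for c
    using j[of c] by (rule joined_mono) auto
  have "(endpt c \<epsilon>', endpt (other c) \<epsilon>') \<in> (adj ?T')\<^sup>*" for c
    using joined_sym[OF j'[of c]] j'[of "other c"] adjI[of \<epsilon> ?T' c]
    by (meson insertI1 r_into_rtrancl rtrancl_trans)
  then have "adj T \<subseteq> (adj ?T')\<^sup>*"
  proof (intro subrelI, elim adjE)
    fix x y c \<delta>
    assume *: "\<And>c. (endpt c \<epsilon>', endpt (other c) \<epsilon>') \<in> (adj ?T')\<^sup>*"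
      and \<delta>: "\<delta> \<in> T" "x = endpt c \<delta>" "y = endpt (other c) \<delta>"
    show "(x, y) \<in> (adj ?T')\<^sup>*"
      using * \<delta> adjI[of \<delta> ?T' c] by (cases "\<delta> = \<epsilon>'") auto
  qed
  then have conn: "(x, y) \<in> (adj T)\<^sup>* \<Longrightarrow> (x, y) \<in> (adj ?T')\<^sup>*" for x y
    using rtrancl_subset_rtrancl by blast
  have conT: "connected_graph V E T" and TB: "T \<subseteq> B" and "forest T"
    using T by (auto simp: spanning_tree_iff)
  have con': "connected_graph V E ?T'" using conT conn by (auto simp: connected_graph_def)
  have ne: "?N \<noteq> {}" using \<epsilon> B by auto
  have "card T + card (comps ?N T) = card ?N"
    using forest_card_comps[OF finT N ins[OF TB] \<open>forest T\<close>] .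
  moreover have "card (comps ?N T) = 1" "card (comps ?N ?T') = 1"
    using card_comps_connected[OF ne] conT con' unfolding connected_graph_def by blast+
  moreover have "card ?T' = card T"
    using \<epsilon>' \<epsilon> finT by (metis Diff_iff card.remove card_insert_disjoint finite_Diff)
  ultimately have "forest ?T'"
    using forestI_card[of ?T' ?N] finT N ins[of ?T'] TB \<epsilon> by auto
  then show ?thesis using con' TB \<epsilon> by (auto simp: spanning_tree_iff)
qed

text \<open>The edge is the one by which a walk leaves \<open>x\<close> for the last time; after it
  the walk stays in \<open>T0\<close>, the graph without the edges at \<open>x\<close>.\<close>

lemma first_edge:
  assumes "(x, y) \<in> (adj T)\<^sup>*" "x \<noteq> y"
  shows "\<exists>\<epsilon>\<in>T. \<exists>c. endpt c \<epsilon> = x \<and> (endpt (other c) \<epsilon>, y) \<in> (adj (T - {\<epsilon>}))\<^sup>*"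
proof -
  define T0 where "T0 = {\<epsilon> \<in> T. \<forall>c. endpt c \<epsilon> \<noteq> x}"
  have "\<exists>\<epsilon>\<in>T. \<exists>c. endpt c \<epsilon> = x \<and> (endpt (other c) \<epsilon>, y) \<in> (adj T0)\<^sup>*"
    using assms
  proof (induction rule: rtrancl_induct)
    case (step y z)
    from step(2) obtain c \<delta> where \<delta>: "\<delta> \<in> T" "y = endpt c \<delta>" "z = endpt (other c) \<delta>" by (rule adjE)
    show ?case
    proof (cases "x = y")
      case False
      then obtain \<epsilon> d where "\<epsilon> \<in> T" "endpt d \<epsilon> = x" "(endpt (other d) \<epsilon>, y) \<in> (adj T0)\<^sup>*"
        using step.IH by blast
      moreover have "endpt d \<delta> \<noteq> x" for d
        using \<delta> False step.prems colour_cases[of d c] by (elim disjE) simp_all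
      then have "\<delta> \<in> T0" unfolding T0_def using \<delta>(1) by blast
      then have "(y, z) \<in> adj T0" using \<delta> by auto
      ultimately show ?thesis by (blast intro: rtrancl.rtrancl_into_rtrancl)
    next
      case True
      have "(endpt (other c) \<delta>, z) \<in> (adj T0)\<^sup>*" using \<delta> by simp
      then show ?thesis using \<delta>(1,2) True by blast
    qed
  qed simp
  then obtain \<epsilon> c where "\<epsilon> \<in> T" "endpt c \<epsilon> = x" "(endpt (other c) \<epsilon>, y) \<in> (adj T0)\<^sup>*" by blast
  moreover have "T0 \<subseteq> T - {\<epsilon>}" unfolding T0_def using \<open>endpt c \<epsilon> = x\<close> by blast
  then have "(endpt (other c) \<epsilon>, y) \<in> (adj (T - {\<epsilon>}))\<^sup>*"
    using \<open>(endpt (other c) \<epsilon>, y) \<in> (adj T0)\<^sup>*\<close> joined_mono by blast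
  ultimately show ?thesis by blast
qed

section \<open>The two sides of a tree edge: the components left when it is deleted\<close>

definition side :: "('v \<times> 'e) set \<Rightarrow> colour \<Rightarrow> 'v \<times> 'e \<Rightarrow> ('v + 'e) set" where
  "side T c \<epsilon> = {x. (endpt c \<epsilon>, x) \<in> (adj (T - {\<epsilon>}))\<^sup>*}"

lemma endpt_in_side [simp]: "endpt c \<epsilon> \<in> side T c \<epsilon>"
  by (simp add: side_def)

lemma side_closed:
  assumes "\<delta> \<in> T" "\<delta> \<noteq> \<epsilon>"
  shows "endpt d \<delta> \<in> side T c \<epsilon> \<longleftrightarrow> endpt d' \<delta> \<in> side T c \<epsilon>"
proof -
  have "(endpt d \<delta>, endpt (other d) \<delta>) \<in> adj (T - {\<epsilon>})" for d using assms by auto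
  then have "endpt d \<delta> \<in> side T c \<epsilon> \<Longrightarrow> endpt (other d) \<delta> \<in> side T c \<epsilon>" for d
    unfolding side_def by (auto intro: rtrancl_into_rtrancl)
  from this[of d] this[of "other d"] show ?thesis using colour_cases[of d' d] by auto
qed

lemma sides_disjoint:
  assumes "forest T" "\<epsilon> \<in> T"
  shows "x \<in> side T c \<epsilon> \<Longrightarrow> x \<notin> side T (other c) \<epsilon>"
proof
  assume "x \<in> side T c \<epsilon>" "x \<in> side T (other c) \<epsilon>"
  then have "(endpt c \<epsilon>, x) \<in> (adj (T - {\<epsilon>}))\<^sup>*" "(x, endpt (other c) \<epsilon>) \<in> (adj (T - {\<epsilon>}))\<^sup>*"
    using joined_sym unfolding side_def by auto
  then show False using forestD[OF assms, of c] rtrancl_trans by metis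
qed

lemma sides_cover:
  assumes "spanning_tree V E B T" "\<epsilon> \<in> T" "x \<in> V <+> E" "endpt c \<epsilon> \<in> V <+> E"
  shows "x \<in> side T c \<epsilon> \<or> x \<in> side T (other c) \<epsilon>"
proof -
  have "(endpt c \<epsilon>, x) \<in> (adj (insert \<epsilon> (T - {\<epsilon>})))\<^sup>*"
    using assms by (simp add: insert_absorb spanning_tree_iff connected_graph_def)
  from joined_insert[OF this] show ?thesis
  proof (elim disjE exE conjE)
    fix d assume "(endpt (other d) \<epsilon>, x) \<in> (adj (T - {\<epsilon>}))\<^sup>*"
    then show ?thesis unfolding side_def using colour_cases[of d c] by auto
  qed (auto simp: side_def)
qed

section \<open>Degree counts of trees with prescribed emerald degrees\<close>

definition realises :: "'e set \<Rightarrow> ('e \<Rightarrow> nat) \<Rightarrow> ('v \<times> 'e) set \<Rightarrow> bool" where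
  "realises E f T \<longleftrightarrow> (\<forall>e\<in>E. card (incident_edges T (Inr e)) = f e + 1)"

lemma hypertree_iff: "hypertree V E G f \<longleftrightarrow> (\<exists>T. spanning_tree V E G T \<and> realises E f T)"
  by (simp add: hypertree_def realises_def)

lemma incident_Inr: "incident_edges T (Inr e) = {\<epsilon> \<in> T. snd \<epsilon> = e}"
proof -
  have "(\<exists>c. endpt c \<epsilon> = Inr e) \<longleftrightarrow> snd \<epsilon> = e" for \<epsilon> :: "'a \<times> 'b"
    by (cases \<epsilon>) (metis (full_types) colour.exhaust endpt.simps sum.distinct(1) sum.inject(2) snd_conv)
  then show ?thesis by (auto simp: incident_edges_def)
qed

text \<open>Every edge has exactly one emerald end, so the count is the sum of
  \<open>f e + 1\<close> over the emerald nodes in \<open>S\<close> and depends on \<open>f\<close>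
  only.\<close>

lemma realises_card_eq:
  assumes fin: "finite V" "finite E" and B: "B \<subseteq> V \<times> E" and T: "T \<subseteq> B" "realises E f T"
    and T': "T' \<subseteq> B" "realises E f T'"
  shows "card {\<delta> \<in> T. endpt Emerald \<delta> \<in> S} = card {\<delta> \<in> T'. endpt Emerald \<delta> \<in> S}"
proof -
  have "card {\<delta> \<in> T. endpt Emerald \<delta> \<in> S} = (\<Sum>e | e \<in> E \<and> Inr e \<in> S. f e + 1)"
    if T: "T \<subseteq> B" "realises E f T" for T
  proof -
    let ?E = "{e. e \<in> E \<and> Inr e \<in> S}"
    have finT: "finite T" using T B fin by (meson finite_SigmaI finite_subset)
    have "{\<delta> \<in> T. endpt Emerald \<delta> \<in> S} = (\<Union>e\<in>?E. incident_edges T (Inr e))"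
      using T B by (auto simp: incident_Inr)
    also have "card \<dots> = (\<Sum>e\<in>?E. card (incident_edges T (Inr e)))"
      using fin finT by (intro card_UN_disjoint) (auto simp: incident_Inr)
    also have "\<dots> = (\<Sum>e\<in>?E. f e + 1)"
      using T(2) by (intro sum.cong) (auto simp: realises_def)
    finally show ?thesis .
  qed
  from this[OF T] this[OF T'] show ?thesis by simp
qed

text \<open>
  The degree sum over the emerald nodes in the side \<open>S\<close> of \<open>\<epsilon>\<close> is \<open>|S|\<close> for \<open>T\<close>: the edges of \<open>T\<close>
  within \<open>S\<close> and \<open>\<epsilon>\<close> itself. A forest with all these edges within \<open>S\<close> has fewer.
\<close>

lemma realisation_crosses:
  assumes fin: "finite V" "finite E" and B: "B \<subseteq> V \<times> E"
    and T: "spanning_tree V E B T" "realises E f T" and \<epsilon>: "\<epsilon> \<in> T"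
    and T': "spanning_tree V E B T'" "realises E f T'"
  shows "\<exists>\<delta>\<in>T'. endpt Emerald \<delta> \<in> side T Emerald \<epsilon> \<and> endpt Violet \<delta> \<notin> side T Emerald \<epsilon>"
proof (rule ccontr)
  assume no: "\<not> ?thesis"
  define S where "S = side T Emerald \<epsilon>"
  have sT: "T \<subseteq> B" "forest T" "T' \<subseteq> B" "forest T'"
    using T T' by (auto simp: spanning_tree_iff)
  have finB: "finite B" using fin B by (meson finite_SigmaI finite_subset)
  have eN: "endpt c \<delta> \<in> V <+> E" if "\<delta> \<in> B" for c \<delta>
    using that B by (cases \<delta>; cases c) auto
  have "S \<subseteq> V <+> E"
  proof
    fix x assume "x \<in> S"
    then have "(endpt Emerald \<epsilon>, x) \<in> (adj (T - {\<epsilon>}))\<^sup>*" by (simp add: S_def side_def)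
    then show "x \<in> V <+> E"
    proof (cases rule: rtrancl.cases)
      case rtrancl_refl then show ?thesis using eN \<epsilon> sT by blast
    next
      case (rtrancl_into_rtrancl b)
      from rtrancl_into_rtrancl(2) obtain c \<delta> where "\<delta> \<in> T - {\<epsilon>}" "x = endpt (other c) \<delta>" by (rule adjE)
      then show ?thesis using eN sT by blast
    qed
  qed
  then have finS: "finite S" using fin by (meson finite_Plus finite_subset)
  have Sne: "S \<noteq> {}" unfolding S_def using endpt_in_side by blast
  have vS: "endpt Violet \<epsilon> \<notin> S"
    unfolding S_def side_def using forestD[OF sT(2) \<epsilon>, of Emerald] by simp
  define F where "F = {\<delta> \<in> T - {\<epsilon>}. endpt Emerald \<delta> \<in> S}"
  have finT: "finite T" "finite T'" using sT finB finite_subset by auto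
  have F: "inside F S" unfolding inside_def F_def
    using side_closed[of _ T \<epsilon> _ Emerald] S_def by blast
  have "(x, y) \<in> (adj F)\<^sup>*" if "x \<in> S" "y \<in> S" for x y
  proof -
    have *: "(endpt Emerald \<epsilon>, x) \<in> (adj F)\<^sup>*" if "x \<in> S" for x
    proof -
      have "(endpt Emerald \<epsilon>, x) \<in> (adj (T - {\<epsilon>}))\<^sup>*" using that by (simp add: S_def side_def)
      then show ?thesis
      proof (induction rule: rtrancl_induct)
        case (step y z)
        from step(2) obtain c \<delta> where \<delta>: "\<delta> \<in> T - {\<epsilon>}" "y = endpt c \<delta>" "z = endpt (other c) \<delta>" by (rule adjE)
        have "y \<in> S" using step(1) by (simp add: S_def side_def)
        then have "\<delta> \<in> F" using \<delta> side_closed[of \<delta> T \<epsilon> c Emerald Emerald] by (auto simp: F_def S_def)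
        then have "(y, z) \<in> adj F" using \<delta> by auto
        then show ?case using step.IH by simp
      qed simp
    qed
    from joined_sym[OF *[OF that(1)]] *[OF that(2)] show ?thesis by (rule rtrancl_trans)
  qed
  then have "card (comps S F) = 1" by (intro card_comps_connected Sne)
  moreover have "card F + card (comps S F) = card S"
    using forest_card_comps[of F S] finS F finT forest_subset[OF sT(2), of F] by (auto simp: F_def)
  moreover have "{\<delta> \<in> T. endpt Emerald \<delta> \<in> S} = insert \<epsilon> F"
    using \<epsilon> endpt_in_side[of Emerald \<epsilon> T] unfolding F_def S_def by blast
  then have "card {\<delta> \<in> T. endpt Emerald \<delta> \<in> S} = Suc (card F)"
    using finT by (simp add: F_def)
  ultimately have cT: "card {\<delta> \<in> T. endpt Emerald \<delta> \<in> S} = card S" by simp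
  define F' where "F' = {\<delta> \<in> T'. endpt Emerald \<delta> \<in> S}"
  \<comment> \<open>By assumption no edge of \<open>T'\<close> leaves \<open>S\<close> from an
    emerald node in \<open>S\<close>. As \<open>S\<close> is nonempty, at least one component
    remains, hence \<open>F'\<close> has fewer than \<open>card S\<close> edges.\<close>
  have "inside F' S" unfolding inside_def
  proof (intro ballI allI)
    fix \<delta> c assume "\<delta> \<in> F'" then show "endpt c \<delta> \<in> S" using no by (cases c) (auto simp: F'_def S_def)
  qed
  then have "card F' + card (comps S F') = card S"
    using forest_card_comps[of F' S] finS finT forest_subset[OF sT(4), of F'] by (auto simp: F'_def)
  moreover have "comps S F' \<noteq> {}" using Sne by (simp add: comps_def)
  then have "card (comps S F') > 0" using finS by (simp add: card_gt_0_iff)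
  moreover have "card {\<delta> \<in> T. endpt Emerald \<delta> \<in> S} = card F'"
    unfolding F'_def by (rule realises_card_eq[OF fin B sT(1) T(2) sT(3) T'(2)])
  ultimately show False using cT by simp
qed

section \<open>Tours of spanning trees\<close>

text \<open>\<open>g\<close> sends \<open>a\<close> to where \<open>f\<close> sends
  \<open>b\<close>, so from \<open>a\<close> it enters the cycle of \<open>b\<close> and follows it
  until \<open>b\<close>. Besides \<open>orbit_merge\<close>, this serves to locate one side of a
  tree edge as an interval of the tour.\<close>

lemma orbit_merge_segment:
  assumes b: "b \<in> orbit f b" and a: "a \<notin> orbit f b"
    and g: "g a = f b" "\<And>z. z \<noteq> a \<Longrightarrow> z \<noteq> b \<Longrightarrow> g z = f z"
  shows "\<exists>m>0. (g ^^ m) a = b \<and> (\<forall>i. 0 < i \<and> i < m \<longrightarrow> (g ^^ i) a \<noteq> b) \<and>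
           orbit f b = (\<lambda>i. (g ^^ i) a) ` {1..m}"
proof -
  define m where "m = funpow_dist1 f b b"
  have m: "0 < m" "(f ^^ m) b = b" "\<And>i. 0 < i \<Longrightarrow> i < m \<Longrightarrow> (f ^^ i) b \<noteq> b"
    unfolding m_def by (simp, rule funpow_dist1_prop[OF b], rule funpow_dist1_least)
  have in_orb: "(f ^^ i) b \<in> orbit f b" for i
    using b by (rule funpow_in_orbit)
  have eq: "(g ^^ i) a = (f ^^ i) b" if "1 \<le> i" "i \<le> m" for i
    using that
  proof (induction i rule: nat_induct_at_least)
    case (Suc i)
    then have "(g ^^ i) a = (f ^^ i) b" "(f ^^ i) b \<noteq> b" using m(3)[of i] by auto
    moreover have "(f ^^ i) b \<noteq> a" using in_orb[of i] a by auto
    ultimately show ?case using g(2) by simp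
  qed (use g in simp)
  have "orbit f b = (\<lambda>i. (f ^^ i) b) ` {1..m}"
  proof (intro equalityI subsetI)
    fix y assume "y \<in> orbit f b"
    then have "y \<in> (\<lambda>i. (f ^^ i) b) ` {0..<m}" unfolding m_def orbit_conv_funpow_dist1[OF b, symmetric] .
    then obtain i where i: "i < m" "y = (f ^^ i) b" by auto
    show "y \<in> (\<lambda>i. (f ^^ i) b) ` {1..m}"
      using i m by (cases "i = 0") (auto intro: image_eqI[of _ _ m])
  next
    fix y assume "y \<in> (\<lambda>i. (f ^^ i) b) ` {1..m}"
    then show "y \<in> orbit f b" using in_orb by auto
  qed
  also have "\<dots> = (\<lambda>i. (g ^^ i) a) ` {1..m}" using eq by (intro image_cong) auto
  finally have "orbit f b = (\<lambda>i. (g ^^ i) a) ` {1..m}" .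
  moreover have "(g ^^ m) a = b" using eq[of m] m by simp
  moreover have "(g ^^ i) a \<noteq> b" if "0 < i" "i < m" for i using eq[of i] m(3)[of i] that by simp
  ultimately show ?thesis using m(1) by blast
qed

text \<open>\<open>g\<close> is the transposition of \<open>a\<close> and \<open>b\<close> followed
  by \<open>f\<close>; as the two points lie on different cycles, this joins the cycles.\<close>

lemma orbit_merge:
  assumes a: "a \<in> orbit f a" and b: "b \<in> orbit f b" and ab: "a \<notin> orbit f b"
    and g: "g a = f b" "g b = f a" "\<And>z. z \<noteq> a \<Longrightarrow> z \<noteq> b \<Longrightarrow> g z = f z"
    and d: "d \<in> orbit f a \<union> orbit f b"
  shows "orbit g d = orbit f a \<union> orbit f b"
proof -
  have ba: "b \<notin> orbit f a" using orbit_swap[OF a] ab by blast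
  obtain m where m: "0 < m" "(g ^^ m) a = b" "orbit f b = (\<lambda>i. (g ^^ i) a) ` {1..m}"
    using orbit_merge_segment[OF b ab g(1,3)] by blast
  obtain k where k: "0 < k" "(g ^^ k) b = a" "orbit f a = (\<lambda>i. (g ^^ i) b) ` {1..k}"
    using orbit_merge_segment[of a f b g] a ba g by blast
  have sub: "orbit f b \<subseteq> orbit g a" "orbit f a \<subseteq> orbit g b"
    using m(3) k(3) by (auto simp: orbit_altdef)
  then have "b \<in> orbit g a" "a \<in> orbit g b" using a b by auto
  then have "a \<in> orbit g a" by (rule orbit_trans[rotated])
  have "orbit g a = orbit f a \<union> orbit f b"
  proof
    show "orbit f a \<union> orbit f b \<subseteq> orbit g a"
      using sub orbit_trans[OF _ \<open>b \<in> orbit g a\<close>] by blast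
    have step: "g y \<in> orbit f a \<union> orbit f b" if "y \<in> orbit f a \<union> orbit f b" for y
      using that g orbit.intros[of f] by (cases "y = a"; cases "y = b") (auto intro: orbit.intros)
    show "orbit g a \<subseteq> orbit f a \<union> orbit f b"
    proof
      fix y assume "y \<in> orbit g a"
      then show "y \<in> orbit f a \<union> orbit f b"
        by induction (use step a in auto)
    qed
  qed
  moreover have "orbit g d = orbit g a" if "d \<in> orbit g a"
    using orbit_cyclic_eq3[of g "orbit g a" d] that \<open>a \<in> orbit g a\<close> by (auto simp: cyclic_on_def)
  ultimately show ?thesis using d by auto
qed

text \<open>The return time of \<open>x\<close> is \<open>card S\<close>, so the times below
  \<open>card S\<close> serve as coordinates on the orbit.\<close>

lemma orbit_enumeration:
  assumes "orbit f x = S" "x \<in> S"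
  shows "(f ^^ card S) x = x" "inj_on (\<lambda>i. (f ^^ i) x) {..<card S}"
    "S = (\<lambda>i. (f ^^ i) x) ` {..<card S}"
proof -
  have x: "x \<in> orbit f x" using assms by simp
  let ?n = "funpow_dist1 f x x"
  have img: "S = (\<lambda>i. (f ^^ i) x) ` {..<?n}"
    using orbit_conv_funpow_dist1[OF x] assms by (simp add: atLeast0LessThan)
  have inj: "inj_on (\<lambda>i. (f ^^ i) x) {..<?n}"
    using inj_on_funpow_dist1[OF x] by (simp add: atLeast0LessThan)
  have "card S = ?n" using card_image[OF inj] unfolding img[symmetric] by simp
  with img inj funpow_dist1_prop[OF x]
  show "(f ^^ card S) x = x" "inj_on (\<lambda>i. (f ^^ i) x) {..<card S}"
    "S = (\<lambda>i. (f ^^ i) x) ` {..<card S}" by simp_all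
qed

text \<open>
  A dart \<open>(c, \<epsilon>)\<close> is the edge \<open>\<epsilon>\<close> seen from its endpoint of colour \<open>c\<close>. The tour of \<open>T\<close> walks along
  the edges of \<open>T\<close> and passes over the other edges of the ambient graph.
\<close>

type_synonym ('v, 'e) dart = "colour \<times> 'v \<times> 'e"

definition darts :: "('v \<times> 'e) set \<Rightarrow> ('v, 'e) dart set" where
  "darts B = UNIV \<times> B"

fun node :: "('v, 'e) dart \<Rightarrow> 'v + 'e" where
  "node (c, \<epsilon>) = endpt c \<epsilon>"

fun rot :: "('v, 'e) ribbon \<Rightarrow> ('v, 'e) dart \<Rightarrow> ('v, 'e) dart" where
  "rot \<rho> (c, \<epsilon>) = (c, \<rho> (endpt c \<epsilon>) \<epsilon>)"

fun flip :: "('v \<times> 'e) set \<Rightarrow> ('v, 'e) dart \<Rightarrow> ('v, 'e) dart" where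
  "flip T (c, \<epsilon>) = (if \<epsilon> \<in> T then other c else c, \<epsilon>)"

definition tour :: "('v, 'e) ribbon \<Rightarrow> ('v \<times> 'e) set \<Rightarrow> ('v, 'e) dart \<Rightarrow> ('v, 'e) dart" where
  "tour \<rho> T d = rot \<rho> (flip T d)"

lemma flip_flip [simp]: "flip T (flip T d) = d"
  by (cases d) auto

lemma snd_flip [simp]: "snd (flip T d) = snd d"
  by (cases d) auto

lemma flip_nontree: "snd d \<notin> T \<Longrightarrow> flip T d = d"
  by (cases d) auto

lemma in_darts [simp]: "d \<in> darts B \<longleftrightarrow> snd d \<in> B"
  by (cases d) (simp add: darts_def)

text \<open>\<open>funpow_dist\<close> gives the time of the first visit, with 0 for
  \<open>d\<^sub>0\<close> itself. For a spanning tree every dart is visited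
  (\<open>tour_orbit_all\<close>), so both times are meaningful.\<close>

definition cut_first ::
    "colour \<Rightarrow> ('v \<times> 'e) set \<Rightarrow> ('v, 'e) ribbon \<Rightarrow> ('v, 'e) dart \<Rightarrow> ('v \<times> 'e) set \<Rightarrow> bool" where
  "cut_first c B \<rho> d\<^sub>0 T \<longleftrightarrow> (\<forall>\<epsilon>\<in>B - T.
     funpow_dist (tour \<rho> T) d\<^sub>0 (c, \<epsilon>) < funpow_dist (tour \<rho> T) d\<^sub>0 (other c, \<epsilon>))"

section \<open>Rotations at the nodes and orbits of the tour\<close>

locale ribbon_graph =
  fixes V :: "'v set" and E :: "'e set" and B :: "('v \<times> 'e) set" and \<rho> :: "('v, 'e) ribbon"
  assumes finite_V: "finite V" and finite_E: "finite E" and B_sub: "B \<subseteq> V \<times> E"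
    and ribbon: "ribbon_structure V E B \<rho>"
begin

lemma finite_B: "finite B"
  using finite_V finite_E B_sub by (meson finite_SigmaI finite_subset)

lemma endpt_node: "\<epsilon> \<in> B \<Longrightarrow> endpt c \<epsilon> \<in> V <+> E"
  using B_sub by (cases c; cases \<epsilon>) auto

lemma incident_edges_endpt:
  "incident_edges B (endpt c \<epsilon>) = {\<delta> \<in> B. endpt c \<delta> = endpt c \<epsilon>}"
  unfolding incident_edges_def using endpt_colour by metis

lemma rho_permutes: "\<epsilon> \<in> B \<Longrightarrow> \<rho> (endpt c \<epsilon>) permutes incident_edges B (endpt c \<epsilon>)"
  using bspec[OF ribbon[unfolded ribbon_structure_def] endpt_node] by (rule conjunct1)

lemma rho_cyclic: "\<epsilon> \<in> B \<Longrightarrow> cyclic_on (\<rho> (endpt c \<epsilon>)) (incident_edges B (endpt c \<epsilon>))"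
  using bspec[OF ribbon[unfolded ribbon_structure_def] endpt_node[of \<epsilon> c]] incident_edges_endpt[of c \<epsilon>]
  by (metis (mono_tags, lifting) empty_Collect_eq)

lemma rho_in:
  assumes "\<epsilon> \<in> B"
  shows "\<rho> (endpt c \<epsilon>) \<epsilon> \<in> B" "endpt c (\<rho> (endpt c \<epsilon>) \<epsilon>) = endpt c \<epsilon>"
proof -
  have "\<rho> (endpt c \<epsilon>) \<epsilon> \<in> incident_edges B (endpt c \<epsilon>)"
    using permutes_in_image[OF rho_permutes[OF assms, of c]] assms incident_edges_endpt[of c \<epsilon>] by blast
  then show "\<rho> (endpt c \<epsilon>) \<epsilon> \<in> B" "endpt c (\<rho> (endpt c \<epsilon>) \<epsilon>) = endpt c \<epsilon>"
    by (auto simp: incident_edges_endpt)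
qed

lemma rot_in: "d \<in> darts B \<Longrightarrow> rot \<rho> d \<in> darts B"
  using rho_in(1) by (cases d) auto

lemma tour_in: "d \<in> darts B \<Longrightarrow> tour \<rho> T d \<in> darts B"
  unfolding tour_def using rot_in[of "flip T d"] by simp

lemma tour_funpow_in: "d \<in> darts B \<Longrightarrow> (tour \<rho> T ^^ k) d \<in> darts B"
  by (induction k) (auto simp del: in_darts intro: tour_in)

text \<open>Without edges the tour rotates around single nodes. Inserting a forest edge exchanges
  the images of its two darts, which lie on different orbits because its ends are not joined yet; so
  the orbits merge exactly as the components do.\<close>

lemma tour_orbit:
  assumes "finite F" "forest F" "F \<subseteq> B" "d \<in> darts B"
  shows "orbit (tour \<rho> F) d = {d' \<in> darts B. (node d, node d') \<in> (adj F)\<^sup>*}"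
  using assms
proof (induction F arbitrary: d)
  case empty
  obtain c \<epsilon> where d: "d = (c, \<epsilon>)" "\<epsilon> \<in> B" using empty.prems by (cases d) auto
  let ?x = "endpt c \<epsilon>"
  have orb: "orbit (\<rho> ?x) \<epsilon> = incident_edges B ?x"
    using orbit_cyclic_eq3[OF rho_cyclic[OF d(2), of c]] d(2) by (simp add: incident_edges_endpt)
  have "Pair c ` orbit (\<rho> ?x) \<epsilon> = orbit (tour \<rho> {}) (c, \<epsilon>)"
  proof (rule orbit_inverse)
    show "\<epsilon> \<in> orbit (\<rho> ?x) \<epsilon>" using orb d(2) by (simp add: incident_edges_endpt)
    fix \<delta> assume "\<delta> \<in> orbit (\<rho> ?x) \<epsilon>"
    then have "endpt c \<delta> = ?x" unfolding orb by (simp add: incident_edges_endpt)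
    then show "tour \<rho> {} (c, \<delta>) = (c, \<rho> ?x \<delta>)" by (simp add: tour_def)
  qed
  then have orb0: "orbit (tour \<rho> {}) (c, \<epsilon>) = Pair c ` incident_edges B ?x" unfolding orb ..
  have eq: "(x, y) \<in> (adj {})\<^sup>* \<longleftrightarrow> x = y" for x y by (simp add: adj_def)
  show ?case
  proof (intro set_eqI)
    fix d' :: "('v, 'e) dart"
    obtain c' \<delta> where d': "d' = (c', \<delta>)" by (cases d')
    have "endpt c \<epsilon> = endpt c' \<delta> \<longleftrightarrow> c' = c \<and> endpt c \<delta> = endpt c \<epsilon>"
      using endpt_colour[of c \<epsilon> c' \<delta>] by auto
    then show "d' \<in> orbit (tour \<rho> {}) d \<longleftrightarrow> d' \<in> {d' \<in> darts B. (node d, node d') \<in> (adj {})\<^sup>*}"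
      using eq unfolding d d' orb0 by (auto simp: incident_edges_endpt)
  qed
next
  case (insert \<epsilon> F)
  let ?f = "tour \<rho> F" and ?g = "tour \<rho> (insert \<epsilon> F)"
  let ?a = "(Violet, \<epsilon>)" and ?b = "(Emerald, \<epsilon>)"
  have F: "forest F" using insert.prems(1) by (rule forest_subset) auto
  have IH: "orbit ?f d = {d' \<in> darts B. (node d, node d') \<in> (adj F)\<^sup>*}" if "d \<in> darts B" for d
    using insert.IH[OF F _ that] insert.prems by auto
  have \<epsilon>: "\<epsilon> \<in> B" using insert.prems by auto
  have nj: "(endpt Emerald \<epsilon>, endpt Violet \<epsilon>) \<notin> (adj F)\<^sup>*"
    using forestD[OF insert.prems(1), of \<epsilon> Emerald] insert.hyps by simp
  have ve: "(endpt c \<epsilon>, endpt c' \<epsilon>) \<in> (adj (insert \<epsilon> F))\<^sup>*" for c c'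
    using adjI[of \<epsilon> "insert \<epsilon> F" c] colour_cases[of c' c] by auto
  have mono: "(x, y) \<in> (adj F)\<^sup>* \<Longrightarrow> (x, y) \<in> (adj (insert \<epsilon> F))\<^sup>*" for x y
    by (erule joined_mono) auto
  have g: "?g ?a = ?f ?b" "?g ?b = ?f ?a" "\<And>z. z \<noteq> ?a \<Longrightarrow> z \<noteq> ?b \<Longrightarrow> ?g z = ?f z"
  proof -
    fix z :: "('v, 'e) dart" assume "z \<noteq> ?a" "z \<noteq> ?b"
    then have "snd z \<noteq> \<epsilon>" using colour_cases[of "fst z" Violet] by (cases z) auto
    then show "?g z = ?f z" by (cases z) (simp add: tour_def)
  qed (use insert.hyps in \<open>simp_all add: tour_def\<close>)
  show ?case
  proof (cases "d \<in> orbit ?f ?a \<union> orbit ?f ?b")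
    case True
    have "orbit ?g d = orbit ?f ?a \<union> orbit ?f ?b"
      by (rule orbit_merge[OF _ _ _ g True]) (use IH \<epsilon> nj in auto)
    also have "\<dots> = {d' \<in> darts B. (node d, node d') \<in> (adj (insert \<epsilon> F))\<^sup>*}"
    proof (intro set_eqI iffI)
      fix d' assume d': "d' \<in> orbit ?f ?a \<union> orbit ?f ?b"
      from True IH \<epsilon> obtain c where "(endpt c \<epsilon>, node d) \<in> (adj F)\<^sup>*" by auto
      moreover from d' IH \<epsilon> obtain c' where "(endpt c' \<epsilon>, node d') \<in> (adj F)\<^sup>*" by auto
      ultimately have "(node d, node d') \<in> (adj (insert \<epsilon> F))\<^sup>*"
        using rtrancl_trans[OF rtrancl_trans[OF joined_sym[OF mono] ve] mono] by blast
      then show "d' \<in> {d' \<in> darts B. (node d, node d') \<in> (adj (insert \<epsilon> F))\<^sup>*}" using d' IH \<epsilon> by auto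
    next
      fix d' assume d': "d' \<in> {d' \<in> darts B. (node d, node d') \<in> (adj (insert \<epsilon> F))\<^sup>*}"
      from True IH \<epsilon> obtain c where c: "(endpt c \<epsilon>, node d) \<in> (adj F)\<^sup>*" by auto
      from d' have "(node d, node d') \<in> (adj (insert \<epsilon> F))\<^sup>*" by simp
      from joined_insert[OF this] rtrancl_trans[OF c] obtain c' where "(endpt c' \<epsilon>, node d') \<in> (adj F)\<^sup>*"
        by blast
      then show "d' \<in> orbit ?f ?a \<union> orbit ?f ?b" using d' IH \<epsilon> by (cases c') auto
    qed
    finally show ?thesis .
  next
    case False
    have d: "d \<in> darts B" using insert.prems by auto
    have no: "(node d, endpt c \<epsilon>) \<notin> (adj F)\<^sup>*" for c
      using False IH[of ?a] IH[of ?b] \<epsilon> d joined_sym[of "node d" "endpt c \<epsilon>" F] by (cases c) auto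
    have "orbit ?g d = orbit ?f d"
    proof (rule orbit_cong)
      show "d \<in> orbit ?f d" using IH d by auto
      fix z assume "z \<in> orbit ?f d"
      then have "z \<noteq> ?a" "z \<noteq> ?b" using IH[OF d] no by auto
      then show "?g z = ?f z" by (rule g(3))
    qed
    moreover have "(node d, y) \<in> (adj (insert \<epsilon> F))\<^sup>* \<longleftrightarrow> (node d, y) \<in> (adj F)\<^sup>*" for y
      using joined_insert[of "node d" y \<epsilon> F] no mono by blast
    ultimately show ?thesis using IH[OF d] by simp
  qed
qed

end

section \<open>Times and positions on the tour of a spanning tree\<close>

locale tree_tour = ribbon_graph +
  fixes T :: "('v \<times> 'e) set" and d\<^sub>0 :: "('v, 'e) dart"
  assumes tree: "spanning_tree V E B T" and base_in: "d\<^sub>0 \<in> darts B"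
begin

abbreviation "at_time k \<equiv> (tour \<rho> T ^^ k) d\<^sub>0"
abbreviation "pos \<equiv> funpow_dist (tour \<rho> T) d\<^sub>0"
abbreviation "period \<equiv> card (darts B)"

lemma T_sub: "T \<subseteq> B" and T_forest: "forest T" and T_connected: "connected_graph V E T"
  using tree by (auto simp: spanning_tree_iff)

lemma finite_T: "finite T"
  using T_sub finite_B finite_subset by blast

lemma node_in: "d \<in> darts B \<Longrightarrow> node d \<in> V <+> E"
  using endpt_node by (cases d) auto

lemma tour_orbit_all: "orbit (tour \<rho> T) d\<^sub>0 = darts B"
proof -
  have "(node d\<^sub>0, node d) \<in> (adj T)\<^sup>*" if "d \<in> darts B" for d
    using bspec[OF bspec[OF T_connected[unfolded connected_graph_def] node_in[OF base_in]] node_in[OF that]] .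
  then show ?thesis
    using tour_orbit[OF finite_T T_forest T_sub base_in] by blast
qed

lemmas enumeration = orbit_enumeration[OF tour_orbit_all base_in]

lemma at_time_in: "at_time k \<in> darts B"
  using base_in by (rule tour_funpow_in)

lemma at_time_pos: "d \<in> darts B \<Longrightarrow> at_time (pos d) = d"
  by (rule funpow_dist_prop) (simp only: tour_orbit_all)

lemma pos_le: "at_time k = d \<Longrightarrow> pos d \<le> k"
  unfolding funpow_dist_def by (rule Least_le)

lemma pos_less: "d \<in> darts B \<Longrightarrow> pos d < period"
  using enumeration(3) pos_le by (metis (no_types, lifting) imageE lessThan_iff order.strict_trans1)

lemma pos_at_time: "k < period \<Longrightarrow> pos (at_time k) = k"
  using inj_onD[OF enumeration(2), of "pos (at_time k)" k] at_time_pos[OF at_time_in] pos_less[OF at_time_in]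
  by simp

lemma pos_eqD: "d \<in> darts B \<Longrightarrow> d' \<in> darts B \<Longrightarrow> pos d = pos d' \<Longrightarrow> d = d'"
  using at_time_pos by metis

text \<open>Within one period \<open>pos\<close> recovers the time, so a repeated dart means a
  completed round. This is how \<open>invariant_stop\<close> reads the stopping condition.\<close>

lemma at_time_eqD:
  assumes "at_time i = at_time j" "i < j"
  shows "period \<le> j"
proof (rule ccontr)
  assume "\<not> period \<le> j"
  then show False using assms pos_at_time[of i] pos_at_time[of j] by simp
qed

text \<open>Deleting \<open>\<epsilon>\<close> splits the tour into one cycle per side. The tour of
  \<open>T\<close> enters the far side right after \<open>(c, \<epsilon>)\<close> and leaves it
  right after \<open>(other c, \<epsilon>)\<close>. The interval is half-open because the first of
  these darts is still on the near side and the second on the far one.\<close>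

lemma side_interval:
  assumes \<epsilon>: "\<epsilon> \<in> T" and less: "pos (c, \<epsilon>) < pos (other c, \<epsilon>)" and d: "d \<in> darts B"
  shows "node d \<in> side T (other c) \<epsilon> \<longleftrightarrow> pos (c, \<epsilon>) < pos d \<and> pos d \<le> pos (other c, \<epsilon>)"
proof -
  let ?f = "tour \<rho> (T - {\<epsilon>})" and ?a = "(c, \<epsilon>)" and ?b = "(other c, \<epsilon>)"
  have \<epsilon>B: "\<epsilon> \<in> B" using \<epsilon> T_sub by auto
  have orb: "orbit ?f ?b = {d \<in> darts B. node d \<in> side T (other c) \<epsilon>}"
    using tour_orbit[of "T - {\<epsilon>}" ?b] forest_subset[OF T_forest, of "T - {\<epsilon>}"] finite_T T_sub \<epsilon>B
    by (auto simp: side_def)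
  have "?b \<in> orbit ?f ?b" unfolding orb using \<epsilon>B by simp
  moreover have "?a \<notin> orbit ?f ?b" unfolding orb
    using sides_disjoint[OF T_forest \<epsilon>, of "endpt c \<epsilon>" c] by simp
  moreover have "tour \<rho> T ?a = ?f ?b" using \<epsilon> by (simp add: tour_def)
  moreover have "tour \<rho> T z = ?f z" if "z \<noteq> ?a" "z \<noteq> ?b" for z
    using that colour_cases[of "fst z" c] by (cases z) (auto simp: tour_def)
  ultimately obtain m where m: "0 < m" "(tour \<rho> T ^^ m) ?a = ?b"
      "\<And>i. 0 < i \<Longrightarrow> i < m \<Longrightarrow> (tour \<rho> T ^^ i) ?a \<noteq> ?b"
      "orbit ?f ?b = (\<lambda>i. (tour \<rho> T ^^ i) ?a) ` {1..m}"
    using orbit_merge_segment[of ?b ?f ?a "tour \<rho> T"] by blast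
  have shift: "(tour \<rho> T ^^ i) ?a = at_time (pos ?a + i)" for i
    using at_time_pos[of ?a] \<epsilon>B by (simp add: add.commute funpow_add)
  have "(tour \<rho> T ^^ (pos ?b - pos ?a)) ?a = ?b"
    unfolding shift using less at_time_pos[of ?b] \<epsilon>B by simp
  \<comment> \<open>\<open>m\<close> is the first time of reaching the second dart from the first,
    so \<open>less\<close> keeps the segment within one period and the time does not wrap
    around.\<close>
  then have "m \<le> pos ?b - pos ?a" using m(3)[of "pos ?b - pos ?a"] less by force
  then have "pos ?a + m < period" using pos_less[of ?b] \<epsilon>B less by simp
  then have pb: "pos ?b = pos ?a + m" using pos_at_time[of "pos ?a + m"] m(2) shift by simp
  have "node d \<in> side T (other c) \<epsilon> \<longleftrightarrow> (\<exists>i\<in>{1..m}. d = at_time (pos ?a + i))"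
    using orb m(4) shift d by (auto simp: image_iff)
  also have "\<dots> \<longleftrightarrow> pos ?a < pos d \<and> pos d \<le> pos ?a + m"
  proof
    assume "\<exists>i\<in>{1..m}. d = at_time (pos ?a + i)"
    then obtain i where i: "1 \<le> i" "i \<le> m" "d = at_time (pos ?a + i)" by auto
    moreover have "pos d = pos ?a + i"
      using pos_at_time[of "pos ?a + i"] i \<open>pos ?a + m < period\<close> by simp
    ultimately show "pos ?a < pos d \<and> pos d \<le> pos ?a + m" by simp
  next
    assume "pos ?a < pos d \<and> pos d \<le> pos ?a + m"
    then show "\<exists>i\<in>{1..m}. d = at_time (pos ?a + i)"
      using at_time_pos[OF d] by (intro bexI[of _ "pos d - pos ?a"]) auto
  qed
  finally show ?thesis unfolding pb .
qed

end

section \<open>Existence of a tree that is cut at one colour\<close>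

text \<open>
  The binary digits of the score record the choices made by the tour; passing over an edge at its
  violet end and walking along an edge from its emerald end are the preferred ones.
\<close>

primrec score :: "('v, 'e) ribbon \<Rightarrow> ('v, 'e) dart \<Rightarrow> ('v \<times> 'e) set \<Rightarrow> nat \<Rightarrow> nat" where
  "score \<rho> d\<^sub>0 T 0 = 0"
| "score \<rho> d\<^sub>0 T (Suc k) = 2 * score \<rho> d\<^sub>0 T k +
     of_bool (fst ((tour \<rho> T ^^ k) d\<^sub>0) = Violet \<longleftrightarrow> snd ((tour \<rho> T ^^ k) d\<^sub>0) \<notin> T)"

lemma tour_agree:
  assumes "\<And>j. j < k \<Longrightarrow> snd ((tour \<rho> T ^^ j) d\<^sub>0) \<in> T \<longleftrightarrow> snd ((tour \<rho> T ^^ j) d\<^sub>0) \<in> T'"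
  shows "(tour \<rho> T' ^^ k) d\<^sub>0 = (tour \<rho> T ^^ k) d\<^sub>0 \<and> score \<rho> d\<^sub>0 T' k = score \<rho> d\<^sub>0 T k"
  using assms
proof (induction k)
  case (Suc k)
  then have IH: "(tour \<rho> T' ^^ k) d\<^sub>0 = (tour \<rho> T ^^ k) d\<^sub>0" "score \<rho> d\<^sub>0 T' k = score \<rho> d\<^sub>0 T k" by auto
  obtain c \<epsilon> where d: "(tour \<rho> T ^^ k) d\<^sub>0 = (c, \<epsilon>)" by (cases "(tour \<rho> T ^^ k) d\<^sub>0")
  have \<epsilon>: "\<epsilon> \<in> T \<longleftrightarrow> \<epsilon> \<in> T'" using Suc.prems[of k] d by simp
  then have "tour \<rho> T' (c, \<epsilon>) = tour \<rho> T (c, \<epsilon>)" by (simp add: tour_def)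
  then show ?case using IH d \<epsilon> by simp
qed simp

text \<open>At time \<open>k\<close>, the first difference, \<open>T\<close> records the digit 0 and
  \<open>T'\<close> the digit 1; later digits cannot reverse the order of the binary
  numbers.\<close>

lemma score_less:
  assumes agree: "\<And>j. j < k \<Longrightarrow> snd ((tour \<rho> T ^^ j) d\<^sub>0) \<in> T \<longleftrightarrow> snd ((tour \<rho> T ^^ j) d\<^sub>0) \<in> T'"
    and d: "(tour \<rho> T ^^ k) d\<^sub>0 = (c, \<epsilon>)"
    and w: "c = Violet \<longleftrightarrow> \<epsilon> \<in> T" "c = Violet \<longleftrightarrow> \<epsilon> \<notin> T'" and "k < m"
  shows "score \<rho> d\<^sub>0 T m < score \<rho> d\<^sub>0 T' m"
proof -
  have "score \<rho> d\<^sub>0 T m < score \<rho> d\<^sub>0 T' m" if "Suc k \<le> m"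
    using that
  proof (induction m rule: dec_induct)
    case base
    have "score \<rho> d\<^sub>0 T' k = score \<rho> d\<^sub>0 T k" "(tour \<rho> T' ^^ k) d\<^sub>0 = (c, \<epsilon>)"
      using tour_agree[OF agree] d by auto
    then show ?case using d w by simp
  next
    case (step m)
    then show ?case by (simp add: of_bool_def)
  qed
  then show ?thesis using \<open>k < m\<close> by simp
qed

lemma realises_exchange:
  assumes T: "realises E f T" "finite T" and "\<epsilon>' \<in> T" "\<epsilon> \<notin> T" "endpt Emerald \<epsilon> = endpt Emerald \<epsilon>'"
  shows "realises E f (insert \<epsilon> (T - {\<epsilon>'}))"
proof -
  have e: "snd \<epsilon> = snd \<epsilon>'" using assms(5) by (cases \<epsilon>; cases \<epsilon>') auto
  have "card (incident_edges (insert \<epsilon> (T - {\<epsilon>'})) (Inr e)) = card (incident_edges T (Inr e))" for e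
  proof (cases "e = snd \<epsilon>")
    case True
    let ?X = "{\<delta> \<in> T. snd \<delta> = e}"
    have "{\<delta> \<in> insert \<epsilon> (T - {\<epsilon>'}). snd \<delta> = e} = insert \<epsilon> (?X - {\<epsilon>'})" using True by auto
    moreover have X: "\<epsilon>' \<in> ?X" "finite ?X" "\<epsilon> \<notin> ?X - {\<epsilon>'}" using assms True e by auto
    moreover have "card (insert \<epsilon> (?X - {\<epsilon>'})) = card ?X"
      using X card.remove[OF X(2,1)] by (simp del: mem_Collect_eq)
    ultimately show ?thesis unfolding incident_Inr by simp
  next
    case False
    then have "{\<delta> \<in> insert \<epsilon> (T - {\<epsilon>'}). snd \<delta> = e} = {\<delta> \<in> T. snd \<delta> = e}" using e by auto
    then show ?thesis by (simp add: incident_Inr)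
  qed
  then show ?thesis using T(1) by (simp add: realises_def)
qed

context ribbon_graph
begin

lemma cut_first_exists:
  assumes hyp: "hypertree V E B f" and d0: "d\<^sub>0 \<in> darts B"
  shows "\<exists>T. spanning_tree V E B T \<and> realises E f T \<and> cut_first Violet B \<rho> d\<^sub>0 T"
proof -
  define S where "S = {T. spanning_tree V E B T \<and> realises E f T}"
  define s where "s T = score \<rho> d\<^sub>0 T (card (darts B))" for T
  have "finite S" by (rule finite_subset[of _ "Pow B"]) (auto simp: S_def spanning_tree_iff finite_B)
  moreover have "S \<noteq> {}" using hyp by (auto simp: S_def hypertree_iff)
  then have "Max (s ` S) \<in> s ` S" and max: "\<And>T'. T' \<in> S \<Longrightarrow> s T' \<le> Max (s ` S)"
    using \<open>finite S\<close> by (blast intro: Max_in, auto)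
  then obtain T where "T \<in> S" "Max (s ` S) = s T" by blast
  with max have T: "T \<in> S" "\<And>T'. T' \<in> S \<Longrightarrow> s T' \<le> s T" by auto
  interpret tree_tour V E B \<rho> T d\<^sub>0
    using T(1) d0 by unfold_locales (auto simp: S_def)
  have "pos (Violet, \<epsilon>) < pos (Emerald, \<epsilon>)" if \<epsilon>: "\<epsilon> \<in> B - T" for \<epsilon>
  proof (rule ccontr)
    assume "\<not> ?thesis"
    moreover have "pos (Violet, \<epsilon>) \<noteq> pos (Emerald, \<epsilon>)" using pos_eqD[of "(Violet, \<epsilon>)" "(Emerald, \<epsilon>)"] \<epsilon> by auto
    ultimately have less: "pos (Emerald, \<epsilon>) < pos (Violet, \<epsilon>)" by simp
    have "(endpt Emerald \<epsilon>, endpt Violet \<epsilon>) \<in> (adj T)\<^sup>*"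
      using T_connected endpt_node \<epsilon> by (auto simp: connected_graph_def)
    moreover have "endpt Emerald \<epsilon> \<noteq> endpt Violet \<epsilon>" using endpt_colour by blast
    \<comment> \<open>\<open>\<epsilon>'\<close> starts the tree path from the emerald end of
      \<open>\<epsilon>\<close> to its violet end, so it lies on the cycle that
      \<open>\<epsilon>\<close> closes. It shares the emerald end, so the exchange keeps all emerald
      degrees.\<close>
    ultimately obtain \<epsilon>' c where \<epsilon>': "\<epsilon>' \<in> T" "endpt c \<epsilon>' = endpt Emerald \<epsilon>"
        "(endpt (other c) \<epsilon>', endpt Violet \<epsilon>) \<in> (adj (T - {\<epsilon>'}))\<^sup>*"
      using first_edge by blast
    have c: "c = Emerald" using \<epsilon>'(2) endpt_colour by blast
    let ?T' = "insert \<epsilon> (T - {\<epsilon>'})"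
    have jV: "(endpt Violet \<epsilon>', endpt Violet \<epsilon>) \<in> (adj (T - {\<epsilon>'}))\<^sup>*" using \<epsilon>'(3) c by simp
    have "(endpt d \<epsilon>, endpt d \<epsilon>') \<in> (adj (T - {\<epsilon>'}))\<^sup>*" for d
      using joined_sym[OF jV] \<epsilon>'(2) c by (cases d) auto
    then have "spanning_tree V E B ?T'"
      using spanning_tree_exchange[OF finite_V finite_E B_sub tree \<epsilon>'(1)] \<epsilon> by auto
    moreover have "realises E f ?T'"
      by (rule realises_exchange) (use T(1) finite_T \<epsilon> \<epsilon>' c in \<open>auto simp: S_def\<close>)
    ultimately have le: "s ?T' \<le> s T" using T(2) by (simp add: S_def)
    \<comment> \<open>If one of these two darts is the first among the four darts of
      \<open>\<epsilon>\<close> and \<open>\<epsilon>'\<close>, then the tours agree up to it, and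
      there the exchanged tree makes the preferred choice: it omits \<open>\<epsilon>'\<close> at
      its violet end or keeps \<open>\<epsilon>\<close> at its emerald end.\<close>
    have better: False
      if d: "d = (Violet, \<epsilon>') \<or> d = (Emerald, \<epsilon>)"
        and min: "\<And>c \<delta>. \<delta> = \<epsilon> \<or> \<delta> = \<epsilon>' \<Longrightarrow> pos d \<le> pos (c, \<delta>)" for d
    proof -
      have dB: "d \<in> darts B" using d \<epsilon> \<epsilon>'(1) T_sub by auto
      have "snd (at_time j) \<in> T \<longleftrightarrow> snd (at_time j) \<in> ?T'" if j: "j < pos d" for j
      proof -
        have "pos (at_time j) < pos d" using j pos_le[of j] order.strict_trans1 by blast
        then have "snd (at_time j) \<noteq> \<epsilon>" "snd (at_time j) \<noteq> \<epsilon>'"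
          using min[of "snd (at_time j)" "fst (at_time j)"] by auto
        then show ?thesis by auto
      qed
      then have "s T < s ?T'" unfolding s_def
      proof (rule score_less)
        show "at_time (pos d) = (fst d, snd d)" using at_time_pos[OF dB] by simp
        show "pos d < period" using pos_less[OF dB] .
      qed (use d \<epsilon> \<epsilon>' in auto)
      then show False using le by simp
    qed
    have \<epsilon>B: "\<epsilon> \<in> B" "\<epsilon>' \<in> B" using \<epsilon> \<epsilon>' T_sub by auto
    have node_e: "node (Emerald, \<epsilon>) = endpt Emerald \<epsilon>'" using \<epsilon>'(2) c by simp
    have "pos (Violet, \<epsilon>') \<noteq> pos (Emerald, \<epsilon>')"
      using pos_eqD[of "(Violet, \<epsilon>')" "(Emerald, \<epsilon>')"] \<epsilon>B by auto
    then consider "pos (Violet, \<epsilon>') < pos (Emerald, \<epsilon>')" | "pos (Emerald, \<epsilon>') < pos (Violet, \<epsilon>')" by linarith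
    then show False
    proof cases
      case 1
      \<comment> \<open>The emerald end of \<open>\<epsilon>\<close> lies on the far side of
        \<open>\<epsilon>'\<close>, which the tour enters through
        \<open>(Violet, \<epsilon>')\<close>.\<close>
      have "pos (Violet, \<epsilon>') < pos (Emerald, \<epsilon>)"
        using side_interval[OF \<epsilon>'(1), of Violet "(Emerald, \<epsilon>)"] 1 \<epsilon>B node_e by simp
      then have "pos (Violet, \<epsilon>') \<le> pos (c, \<delta>)" if "\<delta> = \<epsilon> \<or> \<delta> = \<epsilon>'" for c \<delta>
        using less 1 that by (cases c) auto
      then show False by (intro better[of "(Violet, \<epsilon>')"]) auto
    next
      case 2
      \<comment> \<open>Now the far side contains the violet end of \<open>\<epsilon>\<close> but
        not the emerald one. The dart \<open>(Emerald, \<epsilon>)\<close> precedes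
        \<open>(Violet, \<epsilon>)\<close> and lies outside the interval of that side, hence before
        it.\<close>
      have "node (Violet, \<epsilon>) \<in> side T Violet \<epsilon>'" using jV by (simp add: side_def)
      then have "pos (Violet, \<epsilon>) \<le> pos (Violet, \<epsilon>')"
        using side_interval[OF \<epsilon>'(1), of Emerald "(Violet, \<epsilon>)"] 2 \<epsilon>B by simp
      moreover have "node (Emerald, \<epsilon>) \<notin> side T Violet \<epsilon>'"
        using sides_disjoint[OF T_forest \<epsilon>'(1), of "endpt Emerald \<epsilon>'" Emerald] node_e by simp
      then have "\<not> (pos (Emerald, \<epsilon>') < pos (Emerald, \<epsilon>) \<and> pos (Emerald, \<epsilon>) \<le> pos (Violet, \<epsilon>'))"
        using side_interval[OF \<epsilon>'(1), of Emerald "(Emerald, \<epsilon>)"] 2 \<epsilon>B by simp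
      ultimately have "pos (Emerald, \<epsilon>) \<le> pos (Emerald, \<epsilon>')" using less by linarith
      then have "pos (Emerald, \<epsilon>) \<le> pos (c, \<delta>)" if "\<delta> = \<epsilon> \<or> \<delta> = \<epsilon>'" for c \<delta>
        using less 2 that by (cases c) auto
      then show False by (intro better[of "(Emerald, \<epsilon>)"]) auto
    qed
  qed
  then have "cut_first Violet B \<rho> d\<^sub>0 T" unfolding cut_first_def by simp
  then show ?thesis using T(1) by (auto simp: S_def)
qed

section \<open>Reversing the ribbon structure\<close>

lemma reversed_ribbon: "ribbon_structure V E B (reversed \<rho>)"
  unfolding ribbon_structure_def
proof (intro ballI conjI)
  fix x assume x: "x \<in> V <+> E"
  then have p: "\<rho> x permutes incident_edges B x"
    and c: "incident_edges B x = {} \<or> cyclic_on (\<rho> x) (incident_edges B x)"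
    using ribbon unfolding ribbon_structure_def by auto
  show "reversed \<rho> x permutes incident_edges B x"
    unfolding reversed_def using p by (rule permutes_inv)
  have "finite (incident_edges B x)" using finite_B by (simp add: incident_edges_def)
  then have "permutation (\<rho> x)" using p permutation_permutes by blast
  then show "incident_edges B x = {} \<or> cyclic_on (reversed \<rho> x) (incident_edges B x)"
    using c orbit_inv_eq[of "\<rho> x"] unfolding reversed_def cyclic_on_def by simp
qed

lemma rot_reversed:
  assumes "d \<in> darts B"
  shows "rot (reversed \<rho>) (rot \<rho> d) = d"
proof -
  obtain c \<epsilon> where d: "d = (c, \<epsilon>)" "\<epsilon> \<in> B" using assms by (cases d) auto
  show ?thesis using rho_in[OF d(2), of c] permutes_inverses(2)[OF rho_permutes[OF d(2), of c]]
    by (simp add: d reversed_def)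
qed

end

context tree_tour
begin

text \<open>With \<open>tour \<rho> T = rot \<rho> \<circ> flip T\<close>, the tour of the reversed ribbon structure is conjugate to the inverse
  of the original tour by the involution \<open>flip T\<close>.\<close>

lemma reversed_tour:
  assumes "i < period"
  shows "(tour (reversed \<rho>) T ^^ i) (rot (reversed \<rho>) d\<^sub>0) = flip T (at_time (period - 1 - i))"
  using assms
proof (induction i)
  case 0
  \<comment> \<open>The last step of a round leads back to \<open>d\<^sub>0\<close>, so undoing the
    rotation at \<open>d\<^sub>0\<close> gives the flip of the last dart. This is why the reversed
    process starts at the preceding base edge.\<close>
  then have "tour \<rho> T (at_time (period - 1)) = d\<^sub>0"
    using enumeration(1) by (cases period) auto
  then have "rot \<rho> (flip T (at_time (period - 1))) = d\<^sub>0" by (simp add: tour_def)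
  moreover have "flip T (at_time (period - 1)) \<in> darts B" using at_time_in[of "period - 1"] by simp
  ultimately show ?case using rot_reversed by fastforce
next
  case (Suc i)
  let ?d = "at_time (period - 1 - Suc i)"
  have "at_time (period - 1 - i) = tour \<rho> T ?d"
  proof -
    have "period - 1 - i = Suc (period - 1 - Suc i)" using Suc.prems by simp
    then show ?thesis by (simp only: funpow.simps comp_apply)
  qed
  moreover have "flip T ?d \<in> darts B" using at_time_in[of "period - 1 - Suc i"] by simp
  ultimately have "tour (reversed \<rho>) T (flip T (at_time (period - 1 - i))) = flip T ?d"
    using rot_reversed by (simp add: tour_def)
  then show ?case using Suc by simp
qed

text \<open>\<open>flip T\<close> fixes the darts outside \<open>T\<close>, so these are visited in
  exactly the opposite order, time \<open>i\<close> becoming \<open>period - 1 - i\<close>.\<close>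

lemma cut_first_reversed:
  assumes cut: "cut_first c B \<rho> d\<^sub>0 T"
  shows "cut_first (other c) B (reversed \<rho>) (rot (reversed \<rho>) d\<^sub>0) T"
proof -
  have rev: "ribbon_graph V E B (reversed \<rho>)"
    using finite_V finite_E B_sub reversed_ribbon by unfold_locales
  then interpret r: tree_tour V E B "reversed \<rho>" T "rot (reversed \<rho>) d\<^sub>0"
    using ribbon_graph.rot_in[OF rev base_in] tree by (simp add: tree_tour_def tree_tour_axioms_def)
  have pos: "r.pos d = period - 1 - pos d" if d: "snd d \<in> B - T" for d
  proof -
    have p: "pos d < period" using pos_less d by simp
    then have "r.at_time (period - 1 - pos d) = flip T (at_time (pos d))"
      using reversed_tour[of "period - 1 - pos d"] by simp
    also have "\<dots> = d" using at_time_pos[of d] d flip_nontree[of d T] by auto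
    finally show ?thesis using r.pos_at_time[of "period - 1 - pos d"] p by simp
  qed
  show ?thesis unfolding cut_first_def
  proof
    fix \<epsilon> assume \<epsilon>: "\<epsilon> \<in> B - T"
    then have "pos (c, \<epsilon>) < pos (other c, \<epsilon>)" "pos (other c, \<epsilon>) < period"
      using cut pos_less by (auto simp: cut_first_def)
    then show "r.pos (other c, \<epsilon>) < r.pos (other (other c), \<epsilon>)" using pos \<epsilon> by simp
  qed
qed

end

section \<open>The Bernardi process follows the tour\<close>

text \<open>The cyclic order at the node reaches \<open>\<delta>\<close>, so the
  \<open>LEAST\<close> in \<open>next_edge\<close> is attained; \<open>\<delta> = \<epsilon>\<close>
  is allowed and is reached after a full turn.\<close>

lemma (in ribbon_graph) next_edge_meets:
  assumes \<epsilon>: "\<epsilon> \<in> B" and G: "\<delta> \<in> G" "\<delta> \<in> B" "endpt c \<delta> = endpt c \<epsilon>"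
  shows "\<exists>k>0. next_edge \<rho> G (endpt c \<epsilon>) \<epsilon> = (\<rho> (endpt c \<epsilon>) ^^ k) \<epsilon> \<and> (\<rho> (endpt c \<epsilon>) ^^ k) \<epsilon> \<in> G \<and>
           (\<forall>i. 0 < i \<and> i < k \<longrightarrow> (\<rho> (endpt c \<epsilon>) ^^ i) \<epsilon> \<notin> G)"
proof -
  let ?r = "\<rho> (endpt c \<epsilon>)"
  let ?P = "\<lambda>k. 0 < k \<and> (?r ^^ k) \<epsilon> \<in> G"
  have "\<delta> \<in> orbit ?r \<epsilon>"
    using orbit_cyclic_eq3[OF rho_cyclic[OF \<epsilon>, of c], of \<epsilon>] \<epsilon> G by (simp add: incident_edges_endpt)
  then obtain j where "?P j" using G(1) by (auto simp: orbit_altdef)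
  then have "?P (LEAST k. ?P k)" by (rule LeastI)
  moreover have "\<not> ?P i" if "i < (LEAST k. ?P k)" for i using that by (rule not_less_Least)
  ultimately show ?thesis unfolding next_edge_def by blast
qed

text \<open>The process takes the successor before it removes \<open>\<epsilon>\<close>, while the
  tour meets it in the graph without \<open>\<epsilon>\<close>. They agree because
  \<open>\<delta>\<close> is met before a full turn.\<close>

lemma (in ribbon_graph) next_edge_remove:
  assumes \<epsilon>: "\<epsilon> \<in> B" and G: "\<delta> \<in> G" "\<delta> \<in> B" "endpt c \<delta> = endpt c \<epsilon>" "\<delta> \<noteq> \<epsilon>"
  shows "next_edge \<rho> (G - {\<epsilon>}) (endpt c \<epsilon>) \<epsilon> = next_edge \<rho> G (endpt c \<epsilon>) \<epsilon>"
proof -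
  let ?r = "\<rho> (endpt c \<epsilon>)"
  obtain k where k: "0 < k" "next_edge \<rho> (G - {\<epsilon>}) (endpt c \<epsilon>) \<epsilon> = (?r ^^ k) \<epsilon>" "(?r ^^ k) \<epsilon> \<in> G - {\<epsilon>}"
      "\<And>i. 0 < i \<Longrightarrow> i < k \<Longrightarrow> (?r ^^ i) \<epsilon> \<notin> G - {\<epsilon>}"
    using next_edge_meets[OF \<epsilon>, of \<delta> "G - {\<epsilon>}" c] G by blast
  have no: "(?r ^^ i) \<epsilon> \<notin> G" if i: "0 < i" "i < k" for i
  proof
    assume "(?r ^^ i) \<epsilon> \<in> G"
    then have "(?r ^^ i) \<epsilon> = \<epsilon>" using k(4) i by blast
    \<comment> \<open>A return to \<open>\<epsilon>\<close> after \<open>i\<close> steps makes the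
      edges at \<open>k - i\<close> and \<open>k\<close> coincide, against the minimality of
      \<open>k\<close>.\<close>
    then have "(?r ^^ (k - i)) \<epsilon> = (?r ^^ (k - i + i)) \<epsilon>" by (simp only: funpow_add comp_apply)
    then have "(?r ^^ (k - i)) \<epsilon> = (?r ^^ k) \<epsilon>" using i by simp
    then show False using k(3) k(4)[of "k - i"] i by simp
  qed
  have "(LEAST j. 0 < j \<and> (?r ^^ j) \<epsilon> \<in> G) = k"
    using k(1,3) no by (intro Least_equality) (auto simp: not_less[symmetric])
  then show ?thesis using k(2) by (simp add: next_edge_def)
qed

section \<open>The state of the process read off from the tour\<close>

locale bernardi_run = tree_tour +
  fixes c :: colour and f :: "'b \<Rightarrow> nat"
  assumes cut: "cut_first c B \<rho> d\<^sub>0 T" and realises: "realises E f T"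
begin

definition seen :: "nat \<Rightarrow> ('a, 'b) dart set" where
  "seen t = at_time ` {..<t}"

text \<open>The graph that the process should hold when the tour is at time \<open>t\<close>. As
  \<open>seen t\<close> excludes time \<open>t\<close>, an edge met at \<open>c\<close> for the
  first time at \<open>t\<close> is still present.\<close>

definition current :: "nat \<Rightarrow> ('a \<times> 'b) set" where
  "current t = B - {\<epsilon>. \<epsilon> \<notin> T \<and> (c, \<epsilon>) \<in> seen t}"

definition traversed :: "nat \<Rightarrow> (('a \<times> 'b) \<times> ('a + 'b)) set" where
  "traversed t = {(\<epsilon>, endpt c' \<epsilon>) | c' \<epsilon>. \<epsilon> \<in> T \<and> (c', \<epsilon>) \<in> seen t}"

lemma seen_Suc: "seen (Suc t) = insert (at_time t) (seen t)"
  by (simp add: seen_def lessThan_Suc)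

lemma T_current: "T \<subseteq> current t"
  using T_sub by (auto simp: current_def)

lemma current_sub: "current t \<subseteq> B"
  by (auto simp: current_def)

lemma in_traversed: "(\<epsilon>, endpt c' \<epsilon>) \<in> traversed t \<longleftrightarrow> \<epsilon> \<in> T \<and> (c', \<epsilon>) \<in> seen t"
  unfolding traversed_def using endpt_colour by blast

lemma pos_seen: "d \<in> darts B \<Longrightarrow> pos d < t \<Longrightarrow> d \<in> seen t"
  unfolding seen_def using at_time_pos by (metis imageI lessThan_iff)

lemma current_Suc_tree: "at_time t = (c', \<epsilon>) \<Longrightarrow> \<epsilon> \<in> T \<Longrightarrow> current (Suc t) = current t"
  by (auto simp: current_def seen_Suc)

lemma traversed_Suc_tree:
  "at_time t = (c', \<epsilon>) \<Longrightarrow> \<epsilon> \<in> T \<Longrightarrow> traversed (Suc t) = insert (\<epsilon>, endpt c' \<epsilon>) (traversed t)"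
  by (auto simp: traversed_def seen_Suc)

lemma current_Suc_cut: "at_time t = (c, \<epsilon>) \<Longrightarrow> \<epsilon> \<notin> T \<Longrightarrow> current (Suc t) = current t - {\<epsilon>}"
  by (auto simp: current_def seen_Suc)

lemma traversed_Suc_nontree: "at_time t = (c', \<epsilon>) \<Longrightarrow> \<epsilon> \<notin> T \<Longrightarrow> traversed (Suc t) = traversed t"
  by (auto simp: traversed_def seen_Suc)

lemma current_period:
  assumes "period \<le> t"
  shows "current t = T"
proof -
  have "(c, \<epsilon>) \<in> seen t" if "\<epsilon> \<in> B" for \<epsilon>
    using that pos_seen[of "(c, \<epsilon>)" t] pos_less[of "(c, \<epsilon>)"] assms by simp
  then show ?thesis using T_sub by (auto simp: current_def)
qed

lemma essential:
  assumes t: "at_time t = (c, \<epsilon>)" and \<epsilon>: "\<epsilon> \<in> T"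
  shows "\<not> hypertree V E (current t - {\<epsilon>}) f"
proof
  assume "hypertree V E (current t - {\<epsilon>}) f"
  then obtain T' where T': "spanning_tree V E (current t - {\<epsilon>}) T'" "realises E f T'"
    by (auto simp: hypertree_iff)
  then have sub: "T' \<subseteq> current t - {\<epsilon>}" and T'B: "spanning_tree V E B T'"
    using current_sub by (auto simp: spanning_tree_iff)
  obtain \<delta> where \<delta>: "\<delta> \<in> T'" "endpt Emerald \<delta> \<in> side T Emerald \<epsilon>" "endpt Violet \<delta> \<notin> side T Emerald \<epsilon>"
    using realisation_crosses[OF finite_V finite_E B_sub tree realises \<epsilon> T'B T'(2)] by blast
  have \<delta>B: "\<delta> \<in> B" "\<delta> \<noteq> \<epsilon>" and \<epsilon>B: "\<epsilon> \<in> B" using \<delta>(1) sub current_sub \<epsilon> T_sub by auto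
  have \<delta>T: "\<delta> \<notin> T" using side_closed[of \<delta> T \<epsilon> Emerald Emerald Violet] \<delta> \<delta>B by blast
  have vio: "endpt Violet \<delta> \<in> side T Violet \<epsilon>"
    using sides_cover[OF tree \<epsilon> endpt_node endpt_node, of \<delta> Violet Emerald] \<delta> \<delta>B \<epsilon>B by simp
  \<comment> \<open>\<open>\<delta>\<close> joins the two sides in the same direction as
    \<open>\<epsilon>\<close>, which makes the rest uniform in the colour \<open>c\<close>.\<close>
  have near: "endpt c \<delta> \<in> side T c \<epsilon>" and far: "endpt (other c) \<delta> \<in> side T (other c) \<epsilon>"
    using vio \<delta>(2) by (cases c; simp)+
  have cut\<delta>: "pos (c, \<delta>) < pos (other c, \<delta>)" using cut \<delta>B \<delta>T by (simp add: cut_first_def)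
  have neq: "pos (c, \<delta>) \<noteq> pos (c, \<epsilon>)" using pos_eqD[of "(c, \<delta>)" "(c, \<epsilon>)"] \<delta>B \<epsilon>B by auto
  have "pos (c, \<epsilon>) \<noteq> pos (other c, \<epsilon>)" using pos_eqD[of "(c, \<epsilon>)" "(other c, \<epsilon>)"] \<epsilon>B by auto
  then consider "pos (c, \<epsilon>) < pos (other c, \<epsilon>)" | "pos (other c, \<epsilon>) < pos (c, \<epsilon>)" by linarith
  then have "pos (c, \<delta>) < pos (c, \<epsilon>)"
  proof cases
    case 1
    \<comment> \<open>The far side is the interval after \<open>(c, \<epsilon>)\<close>. The far end
      of \<open>\<delta>\<close> is met within it; the near end is met earlier and outside it, hence
      before it.\<close>
    have "pos (other c, \<delta>) \<le> pos (other c, \<epsilon>)"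
      using side_interval[OF \<epsilon> 1, of "(other c, \<delta>)"] far \<delta>B by simp
    moreover have "\<not> (pos (c, \<epsilon>) < pos (c, \<delta>) \<and> pos (c, \<delta>) \<le> pos (other c, \<epsilon>))"
      using side_interval[OF \<epsilon> 1, of "(c, \<delta>)"] sides_disjoint[OF T_forest \<epsilon> near] \<delta>B by simp
    ultimately show ?thesis using cut\<delta> neq by linarith
  next
    case 2
    \<comment> \<open>Here the side that contains the \<open>c\<close> end of
      \<open>\<delta>\<close> is the interval that ends with \<open>(c, \<epsilon>)\<close>.\<close>
    then show ?thesis using side_interval[OF \<epsilon>, of "other c" "(c, \<delta>)"] near \<delta>B neq by simp
  qed
  also have "\<dots> \<le> t" using t by (rule pos_le)
  finally have "(c, \<delta>) \<in> seen t" using pos_seen \<delta>B by simp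
  then have "\<delta> \<notin> current t" using \<delta>T by (simp add: current_def)
  then show False using \<delta>(1) sub by auto
qed

text \<open>This turns the test of the process into membership in \<open>T\<close>: removing an edge
  outside \<open>T\<close> leaves \<open>T\<close> as a witness, and \<open>essential\<close>
  handles the edges of \<open>T\<close>.\<close>

lemma hypertree_current:
  assumes "at_time t = (c, \<epsilon>)"
  shows "hypertree V E (current t - {\<epsilon>}) f \<longleftrightarrow> \<epsilon> \<notin> T"
proof
  assume "\<epsilon> \<notin> T"
  then have "spanning_tree V E (current t - {\<epsilon>}) T"
    using tree T_current[of t] by (auto simp: spanning_tree_iff)
  then show "hypertree V E (current t - {\<epsilon>}) f" using realises by (auto simp: hypertree_iff)
qed (use essential[OF assms] in blast)

lemma tree_edge_at:
  assumes "\<epsilon> \<in> B"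
  obtains \<delta> where "\<delta> \<in> T" "endpt c' \<delta> = endpt c' \<epsilon>"
proof -
  have "(endpt c' \<epsilon>, endpt (other c') \<epsilon>) \<in> (adj T)\<^sup>*"
    using bspec[OF bspec[OF T_connected[unfolded connected_graph_def] endpt_node[OF assms]] endpt_node[OF assms]] .
  moreover have "endpt c' \<epsilon> \<noteq> endpt (other c') \<epsilon>" using endpt_colour other_neq by metis
  ultimately obtain \<delta> d where "\<delta> \<in> T" "endpt d \<delta> = endpt c' \<epsilon>" using first_edge by blast
  then show thesis using that endpt_colour by metis
qed

text \<open>The edges that the tour passes over before it reaches the next edge of the process are
  missing from the current graph, hence outside \<open>T\<close>, so the tour stays at the node. The
  colour clause lets \<open>traverse_step\<close> exclude visits at colour \<open>c\<close> in
  between.\<close>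

lemma advance:
  assumes t: "at_time t = rot \<rho> (c', \<epsilon>)" and \<epsilon>: "\<epsilon> \<in> B"
  shows "\<exists>t'\<ge>t. at_time t' = (c', next_edge \<rho> (current t) (endpt c' \<epsilon>) \<epsilon>) \<and>
    next_edge \<rho> (current t) (endpt c' \<epsilon>) \<epsilon> \<in> current t \<and> current t' = current t \<and>
    traversed t' = traversed t \<and> (\<forall>s. t \<le> s \<and> s < t' \<longrightarrow> fst (at_time s) = c')"
proof -
  let ?r = "\<rho> (endpt c' \<epsilon>)"
  obtain \<delta> where \<delta>: "\<delta> \<in> T" "endpt c' \<delta> = endpt c' \<epsilon>" using tree_edge_at[OF \<epsilon>] by blast
  obtain k where k: "0 < k" "next_edge \<rho> (current t) (endpt c' \<epsilon>) \<epsilon> = (?r ^^ k) \<epsilon>" "(?r ^^ k) \<epsilon> \<in> current t"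
      "\<And>i. 0 < i \<Longrightarrow> i < k \<Longrightarrow> (?r ^^ i) \<epsilon> \<notin> current t"
    using next_edge_meets[OF \<epsilon>, of \<delta> "current t" c'] \<delta> T_current[of t] T_sub by blast
  have end_r: "endpt c' ((?r ^^ i) \<epsilon>) = endpt c' \<epsilon> \<and> (?r ^^ i) \<epsilon> \<in> B" for i
  proof (induction i)
    case (Suc i)
    then show ?case using rho_in[of "(?r ^^ i) \<epsilon>" c'] by simp
  qed (use \<epsilon> in simp)
  \<comment> \<open>The dart at time \<open>t\<close> has already been rotated once, hence
    \<open>Suc i\<close> here and the arrival time \<open>t + (k - 1)\<close> below.\<close>
  have along: "at_time (t + i) = (c', (?r ^^ Suc i) \<epsilon>) \<and> current (t + i) = current t \<and>
      traversed (t + i) = traversed t" if "i < k" for i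
    using that
  proof (induction i)
    case 0
    then show ?case using t by simp
  next
    case (Suc i)
    let ?\<delta> = "(?r ^^ Suc i) \<epsilon>"
    have IH: "at_time (t + i) = (c', ?\<delta>)" "current (t + i) = current t" "traversed (t + i) = traversed t"
      using Suc by auto
    have notin: "?\<delta> \<notin> current t" using k(4)[of "Suc i"] Suc.prems by simp
    then have nT: "?\<delta> \<notin> T" using T_current by blast
    have "at_time (t + Suc i) = (c', (?r ^^ Suc (Suc i)) \<epsilon>)"
      using IH(1) nT end_r[of "Suc i"] by (simp add: tour_def)
    \<comment> \<open>At colour \<open>c\<close> the edge passed over is already gone; at the other
      colour nothing is cut.\<close>
    moreover have "current (Suc (t + i)) = current (t + i)"
    proof (cases "c' = c")
      case True
      then show ?thesis using current_Suc_cut[of "t + i" ?\<delta>] IH nT notin by simp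
    next
      case False
      then show ?thesis using IH(1) by (auto simp: current_def seen_Suc)
    qed
    ultimately show ?case using IH traversed_Suc_nontree[OF IH(1) nT] by simp
  qed
  have "\<forall>s. t \<le> s \<and> s < t + (k - 1) \<longrightarrow> fst (at_time s) = c'"
  proof (intro allI impI)
    fix s assume s: "t \<le> s \<and> s < t + (k - 1)"
    then have "t + (s - t) = s" "s - t < k" by auto
    then show "fst (at_time s) = c'" using along[of "s - t"] by simp
  qed
  then show ?thesis
    using along[of "k - 1"] k(1-3) by (intro exI[of _ "t + (k - 1)"]) simp
qed

lemma at_time_Suc_tree: "at_time t = (c', \<epsilon>) \<Longrightarrow> \<epsilon> \<in> T \<Longrightarrow> at_time (Suc t) = rot \<rho> (other c', \<epsilon>)"
  by (simp add: tour_def)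

lemma at_time_Suc_nontree: "at_time t = (c', \<epsilon>) \<Longrightarrow> \<epsilon> \<notin> T \<Longrightarrow> at_time (Suc t) = rot \<rho> (c', \<epsilon>)"
  by (simp add: tour_def)

text \<open>Some tree edge at the node of \<open>\<epsilon>\<close> differs from
  \<open>\<epsilon>\<close>, so \<open>next_edge_remove\<close> applies, and \<open>advance\<close>
  continues the tour in the smaller graph.\<close>

lemma cut_step:
  assumes t: "at_time t = (c, \<epsilon>)" and \<epsilon>: "\<epsilon> \<in> current t" "\<epsilon> \<notin> T"
  shows "\<exists>t'. at_time t' = (c, next_edge \<rho> (current t) (endpt c \<epsilon>) \<epsilon>) \<and>
    next_edge \<rho> (current t) (endpt c \<epsilon>) \<epsilon> \<in> current t' \<and> current t' = current t - {\<epsilon>} \<and>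
    traversed t' = traversed t"
proof -
  have \<epsilon>B: "\<epsilon> \<in> B" using \<epsilon> current_sub by auto
  obtain \<delta> where \<delta>: "\<delta> \<in> T" "endpt c \<delta> = endpt c \<epsilon>" using tree_edge_at[OF \<epsilon>B] by blast
  have "next_edge \<rho> (current t - {\<epsilon>}) (endpt c \<epsilon>) \<epsilon> = next_edge \<rho> (current t) (endpt c \<epsilon>) \<epsilon>"
    using next_edge_remove[OF \<epsilon>B, of \<delta> "current t" c] \<delta> \<epsilon> T_current[of t] T_sub by blast
  then show ?thesis
    using advance[OF at_time_Suc_nontree[OF t \<epsilon>(2)] \<epsilon>B] current_Suc_cut[OF t \<epsilon>(2)]
      traversed_Suc_nontree[OF t \<epsilon>(2)] by auto
qed

text \<open>An edge met first at its endpoint of the other colour lies in \<open>T\<close>, because \<open>T\<close> is cut at \<open>c\<close>; the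
  process, which does not test such an edge, therefore agrees with the tour.\<close>

lemma traverse_step:
  assumes t: "at_time t = (c, \<epsilon>)" and \<epsilon>: "\<epsilon> \<in> T"
    and \<epsilon>': "\<epsilon>' = next_edge \<rho> (current t) (endpt (other c) \<epsilon>) \<epsilon>"
  obtains t\<^sub>1 where "t < t\<^sub>1" "at_time t\<^sub>1 = (other c, \<epsilon>')" "\<epsilon>' \<in> T" "current t\<^sub>1 = current t"
    "traversed t\<^sub>1 = insert (\<epsilon>, endpt c \<epsilon>) (traversed t)"
proof -
  have \<epsilon>B: "\<epsilon> \<in> B" using \<epsilon> T_sub by auto
  have same: "current (Suc t) = current t" using t \<epsilon> by (rule current_Suc_tree)
  obtain t\<^sub>1 where t1: "Suc t \<le> t\<^sub>1" "at_time t\<^sub>1 = (other c, \<epsilon>')" "\<epsilon>' \<in> current t"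
      "current t\<^sub>1 = current t" "traversed t\<^sub>1 = traversed (Suc t)"
      "\<And>s. Suc t \<le> s \<Longrightarrow> s < t\<^sub>1 \<Longrightarrow> fst (at_time s) = other c"
    using advance[OF at_time_Suc_tree[OF t \<epsilon>] \<epsilon>B] unfolding same \<epsilon>' by blast
  have "\<epsilon>' \<in> T"
  proof (rule ccontr)
    assume nT: "\<epsilon>' \<notin> T"
    have \<epsilon>'B: "\<epsilon>' \<in> B" using t1(3) current_sub by auto
    \<comment> \<open>\<open>s\<close> is the first time that \<open>\<epsilon>'\<close> is met at
      colour \<open>c\<close>, and it is before \<open>t\<^sub>1\<close>. Before \<open>t\<close>,
      the edge would have been cut; at \<open>t\<close> the edge is in \<open>T\<close>; between
      \<open>t\<close> and \<open>t\<^sub>1\<close> all darts have the other colour.\<close>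
    define s where "s = pos (c, \<epsilon>')"
    have s: "at_time s = (c, \<epsilon>')" unfolding s_def using at_time_pos[of "(c, \<epsilon>')"] \<epsilon>'B by simp
    have "s < pos (other c, \<epsilon>')" using cut \<epsilon>'B nT by (simp add: cut_first_def s_def)
    also have "\<dots> \<le> t\<^sub>1" using t1(2) by (rule pos_le)
    finally have "s < t\<^sub>1" .
    moreover have "s \<noteq> t" using s t nT \<epsilon> by auto
    moreover have "\<not> s < t"
    proof
      assume "s < t"
      then have "(c, \<epsilon>') \<in> seen t" using s unfolding seen_def by (metis imageI lessThan_iff)
      then show False using t1(3) nT by (simp add: current_def)
    qed
    ultimately show False using t1(6)[of s] s by simp
  qed
  then show thesis using that[of t\<^sub>1] t1 traversed_Suc_tree[OF t \<epsilon>] by simp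
qed

section \<open>Invariant, termination and outcome\<close>

fun invariant :: "('a, 'b) state \<Rightarrow> bool" where
  "invariant (G, \<epsilon>, R) \<longleftrightarrow>
     (\<exists>t. at_time t = (c, \<epsilon>) \<and> \<epsilon> \<in> current t \<and> G = current t \<and> R = traversed t)"

text \<open>Termination measure: a step removes an edge or records a new traversal, of which only
  finitely many exist.\<close>

fun remaining :: "('a, 'b) state \<Rightarrow> nat" where
  "remaining (G, \<epsilon>, R) = card G + card (B \<times> (V <+> E) - R)"

text \<open>One step may pass over many darts, so the invariant only asks for some time of the tour.
  A traversing step is matched by \<open>traverse_step\<close> up to the other colour and by
  \<open>advance\<close> back at \<open>c\<close>.\<close>

lemma invariant_step:
  assumes inv: "invariant s" and go: "\<not> bernardi_stop c V E \<rho> f s"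
  shows "invariant (bernardi_step c V E \<rho> f s) \<and> remaining (bernardi_step c V E \<rho> f s) < remaining s"
proof -
  obtain G \<epsilon> R where s: "s = (G, \<epsilon>, R)" by (cases s)
  obtain t where t: "at_time t = (c, \<epsilon>)" "\<epsilon> \<in> current t" and G: "G = current t" and R: "R = traversed t"
    using inv s by auto
  have fin: "finite G" using G current_sub finite_B finite_subset by blast
  show ?thesis
  proof (cases "\<epsilon> \<in> T")
    case False
    have step: "bernardi_step c V E \<rho> f s = (G - {\<epsilon>}, next_edge \<rho> G (endpt c \<epsilon>) \<epsilon>, R)"
      using hypertree_current[OF t(1)] False by (simp add: s bernardi_step_def G)
    have "card (G - {\<epsilon>}) < card G" using fin t(2) G by (intro psubset_card_mono) auto
    then show ?thesis unfolding step using cut_step[OF t False] by (auto simp: s G R)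
  next
    case True
    define \<epsilon>' where "\<epsilon>' = next_edge \<rho> G (endpt (other c) \<epsilon>) \<epsilon>"
    define \<epsilon>'' where "\<epsilon>'' = next_edge \<rho> G (endpt c \<epsilon>') \<epsilon>'"
    define R' where "R' = R \<union> {(\<epsilon>, endpt c \<epsilon>), (\<epsilon>', endpt (other c) \<epsilon>')}"
    have nh: "\<not> hypertree V E (G - {\<epsilon>}) f" using hypertree_current[OF t(1)] True G by simp
    have step: "bernardi_step c V E \<rho> f s = (G, \<epsilon>'', R')"
      using nh by (simp add: s bernardi_step_def \<epsilon>'_def \<epsilon>''_def R'_def Let_def)
    obtain t\<^sub>1 where t1: "at_time t\<^sub>1 = (other c, \<epsilon>')" "\<epsilon>' \<in> T" "current t\<^sub>1 = current t"
        "traversed t\<^sub>1 = insert (\<epsilon>, endpt c \<epsilon>) (traversed t)"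
      using traverse_step[OF t(1) True, of \<epsilon>'] unfolding \<epsilon>'_def G by metis
    have \<epsilon>'B: "\<epsilon>' \<in> B" using t1(2) T_sub by auto
    have same: "current (Suc t\<^sub>1) = current t" "traversed (Suc t\<^sub>1) = R'"
      using current_Suc_tree[OF t1(1,2)] traversed_Suc_tree[OF t1(1,2)] t1(3,4) by (auto simp: R'_def R)
    have rot1: "at_time (Suc t\<^sub>1) = rot \<rho> (c, \<epsilon>')" using at_time_Suc_tree[OF t1(1,2)] by simp
    obtain t\<^sub>2 where "at_time t\<^sub>2 = (c, \<epsilon>'')" "\<epsilon>'' \<in> current t\<^sub>2" "current t\<^sub>2 = G" "traversed t\<^sub>2 = R'"
      using advance[OF rot1 \<epsilon>'B] unfolding same \<epsilon>''_def G by metis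
    then have inv': "invariant (G, \<epsilon>'', R')" by auto
    \<comment> \<open>The first of the two traversals is new because the process goes on, which
      gives the strict decrease.\<close>
    have "(\<epsilon>, endpt c \<epsilon>) \<notin> R"
      using go nh by (simp add: s bernardi_stop_def Let_def)
    moreover have "(\<epsilon>, endpt c \<epsilon>) \<in> B \<times> (V <+> E)" by (intro SigmaI endpt_node) (use True T_sub in auto)
    moreover have "x \<notin> R \<Longrightarrow> x \<in> U \<Longrightarrow> U - (R \<union> {x, y}) \<subset> U - R" for x y U by blast
    ultimately have "B \<times> (V <+> E) - R' \<subset> B \<times> (V <+> E) - R" unfolding R'_def by simp
    then have "card (B \<times> (V <+> E) - R') < card (B \<times> (V <+> E) - R)"
      using finite_B finite_V finite_E by (intro psubset_card_mono) auto
    then show ?thesis unfolding step using inv' by (simp add: s)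
  qed
qed

lemma invariant_stop:
  assumes inv: "invariant s" and stop: "bernardi_stop c V E \<rho> f s"
  shows "fst s = T"
proof -
  obtain G \<epsilon> R where s: "s = (G, \<epsilon>, R)" by (cases s)
  obtain t where t: "at_time t = (c, \<epsilon>)" "\<epsilon> \<in> current t" and G: "G = current t" and R: "R = traversed t"
    using inv s by auto
  define \<epsilon>' where "\<epsilon>' = next_edge \<rho> G (endpt (other c) \<epsilon>) \<epsilon>"
  have late: "period \<le> j" if "d \<in> seen i" "at_time j = d" "i \<le> j" for d i j
    using that at_time_eqD[of _ j] by (auto simp: seen_def)
  have "\<not> hypertree V E (G - {\<epsilon>}) f"
    and again: "(\<epsilon>, endpt c \<epsilon>) \<in> R \<or> (\<epsilon>', endpt (other c) \<epsilon>') \<in> R"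
    using stop by (auto simp: s bernardi_stop_def Let_def \<epsilon>'_def)
  then have \<epsilon>: "\<epsilon> \<in> T" using hypertree_current[OF t(1)] G by blast
  obtain t\<^sub>1 where t1: "t < t\<^sub>1" "at_time t\<^sub>1 = (other c, \<epsilon>')" "current t\<^sub>1 = current t"
    using traverse_step[OF t(1) \<epsilon>, of \<epsilon>'] unfolding \<epsilon>'_def G by metis
  \<comment> \<open>A repeated traversal is a dart met twice by the tour, so a full round is over
    and every edge outside \<open>T\<close> has been met at \<open>c\<close>. If the second
    traversal repeats, the graph at \<open>t\<^sub>1\<close> is still the one at
    \<open>t\<close>.\<close>
  have "period \<le> t \<or> period \<le> t\<^sub>1"
    using again late[of "(c, \<epsilon>)" t t] late[of "(other c, \<epsilon>')" t t\<^sub>1] t t1 unfolding R in_traversed by auto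
  then show ?thesis using current_period t1(3) by (auto simp: s G)
qed

lemma invariant_start:
  assumes d0: "d\<^sub>0 = (c\<^sub>0, \<beta>)"
  shows "invariant (bernardi_start c B \<rho> (endpt c\<^sub>0 \<beta>) \<beta>)"
proof -
  have \<beta>: "\<beta> \<in> B" using base_in d0 by simp
  have start: "current 0 = B" "traversed 0 = {}" by (auto simp: current_def traversed_def seen_def)
  show ?thesis
  proof (cases "c\<^sub>0 = c")
    case True
    then have "at_time 0 = (c, \<beta>)" using d0 by simp
    then have "invariant (B, \<beta>, {})" using start \<beta> invariant.simps by metis
    then show ?thesis using True by (simp add: bernardi_start_def)
  next
    case False
    then have c0: "c\<^sub>0 = other c" using colour_cases by blast
    \<comment> \<open>The base dart has time 0 at the other colour, so outside \<open>T\<close> the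
      base edge would violate \<open>cut\<close>. Hence the tour too begins by traversing it, and
      the process starts after that step.\<close>
    have "\<beta> \<in> T"
    proof (rule ccontr)
      assume "\<beta> \<notin> T"
      then have "pos (c, \<beta>) < pos (other c, \<beta>)" using cut \<beta> by (simp add: cut_first_def)
      moreover have "pos (other c, \<beta>) = 0" using pos_le[of 0 "(other c, \<beta>)"] d0 c0 by simp
      ultimately show False by simp
    qed
    have at0: "at_time 0 = (other c, \<beta>)" using d0 c0 by simp
    have one: "at_time (Suc 0) = rot \<rho> (c, \<beta>)" "current (Suc 0) = B"
        "traversed (Suc 0) = {(\<beta>, endpt (other c) \<beta>)}"
      using at_time_Suc_tree[OF at0 \<open>\<beta> \<in> T\<close>] current_Suc_tree[OF at0 \<open>\<beta> \<in> T\<close>]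
        traversed_Suc_tree[OF at0 \<open>\<beta> \<in> T\<close>] start by auto
    have "endpt (other c) \<beta> \<noteq> endpt c \<beta>" using endpt_colour other_neq by metis
    then have "bernardi_start c B \<rho> (endpt c\<^sub>0 \<beta>) \<beta> =
        (B, next_edge \<rho> B (endpt c \<beta>) \<beta>, {(\<beta>, endpt (other c) \<beta>)})"
      by (simp add: bernardi_start_def c0)
    then show ?thesis using advance[OF one(1) \<beta>] unfolding one(2,3) by auto
  qed
qed

lemma bernardi_outcome_eq:
  assumes "d\<^sub>0 = (c\<^sub>0, \<beta>)" and B: "B = Bip E inc"
  shows "bernardi_outcome c V E inc \<rho> f (endpt c\<^sub>0 \<beta>) \<beta> = Some T"
proof -
  let ?b = "\<lambda>s. \<not> bernardi_stop c V E \<rho> f s" and ?s = "bernardi_step c V E \<rho> f"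
  let ?init = "bernardi_start c (Bip E inc) \<rho> (endpt c\<^sub>0 \<beta>) \<beta>"
  have init: "invariant ?init" using invariant_start[OF assms(1)] B by simp
  obtain s where s: "while_option ?b ?s ?init = Some s"
    using measure_while_option_Some[of invariant ?b ?s remaining, OF invariant_step init] by blast
  have "invariant s"
    using while_option_rule[of invariant ?b ?s, OF _ s init] invariant_step by blast
  moreover have "bernardi_stop c V E \<rho> f s" using while_option_stop[OF s] by simp
  ultimately have "fst s = T" by (rule invariant_stop)
  then show ?thesis by (simp add: bernardi_outcome_def s)
qed

end

section \<open>Both processes end with the same tree\<close>

theorem theorem6p20:
  fixes V :: "'v set" and E :: "'e set" and inc :: "'e \<Rightarrow> 'v set"
    and \<rho> :: "('v, 'e) ribbon"
    and b\<^sub>0 :: "'v + 'e" and \<beta> :: "'v \<times> 'e"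
    and f :: "'e \<Rightarrow> nat"
  assumes "hypergraph V E inc"
    and "connected_graph V E (Bip E inc)"
    and "ribbon_structure V E (Bip E inc) \<rho>"
    and "b\<^sub>0 \<in> V <+> E" and "\<beta> \<in> incident_edges (Bip E inc) b\<^sub>0"
    and "hypertree V E (Bip E inc) f"
  shows "\<exists>T. spanning_tree V E (Bip E inc) T \<and>
           bernardi_outcome Violet V E inc \<rho> f b\<^sub>0 \<beta> = Some T \<and>
           bernardi_outcome Emerald V E inc (reversed \<rho>) f b\<^sub>0 (inv (\<rho> b\<^sub>0) \<beta>) = Some T"
proof -
  have fin: "finite V" "finite E" and sub: "Bip E inc \<subseteq> V \<times> E"
    using assms(1) by (auto simp: hypergraph_def Bip_def)
  interpret ribbon_graph V E "Bip E inc" \<rho>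
    using fin sub assms(3) by unfold_locales
  obtain c\<^sub>0 where \<beta>: "\<beta> \<in> Bip E inc" and b0: "b\<^sub>0 = endpt c\<^sub>0 \<beta>"
    using assms(5) by (auto simp: incident_edges_def)
  \<comment> \<open>This one tree is the outcome of both processes: it is cut at the violet nodes
    here and at the emerald nodes for the reversed tour.\<close>
  obtain T where tree: "spanning_tree V E (Bip E inc) T" and real: "realises E f T"
      and cut: "cut_first Violet (Bip E inc) \<rho> (c\<^sub>0, \<beta>) T"
    using cut_first_exists[OF assms(6), of "(c\<^sub>0, \<beta>)"] \<beta> by auto
  interpret t: tree_tour V E "Bip E inc" \<rho> T "(c\<^sub>0, \<beta>)"
    using tree \<beta> by unfold_locales auto
  interpret v: bernardi_run V E "Bip E inc" \<rho> T "(c\<^sub>0, \<beta>)" Violet f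
    using cut real by unfold_locales
  define \<beta>' where "\<beta>' = inv (\<rho> b\<^sub>0) \<beta>"
  have rot: "rot (reversed \<rho>) (c\<^sub>0, \<beta>) = (c\<^sub>0, \<beta>')" by (simp add: reversed_def \<beta>'_def b0)
  interpret r: ribbon_graph V E "Bip E inc" "reversed \<rho>"
    using fin sub reversed_ribbon by unfold_locales
  have \<beta>': "\<beta>' \<in> Bip E inc" "endpt c\<^sub>0 \<beta>' = b\<^sub>0"
    using r.rho_in[OF \<beta>, of c\<^sub>0] by (simp_all add: reversed_def \<beta>'_def b0)
  have "cut_first Emerald (Bip E inc) (reversed \<rho>) (c\<^sub>0, \<beta>') T"
    using t.cut_first_reversed[OF cut] unfolding rot by simp
  then interpret e: bernardi_run V E "Bip E inc" "reversed \<rho>" T "(c\<^sub>0, \<beta>')" Emerald f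
    using tree real \<beta>'(1) by unfold_locales auto
  have "bernardi_outcome Violet V E inc \<rho> f b\<^sub>0 \<beta> = Some T"
    unfolding b0 by (rule v.bernardi_outcome_eq[OF refl refl])
  moreover have "bernardi_outcome Emerald V E inc (reversed \<rho>) f b\<^sub>0 \<beta>' = Some T"
    unfolding \<beta>'(2)[symmetric] by (rule e.bernardi_outcome_eq[OF refl refl])
  ultimately show ?thesis using tree unfolding \<beta>'_def by (intro exI[of _ T] conjI)
qed

end
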